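(* Let $W'$ be a folding of a Coxeter group $W$. If $W$ is futuristic, then $W'$ is futuristic.
   Context: Let $(W,S)$ be a Coxeter system with $S=\{s_i:i\in I\}$, $I$ a finite index set; $m(i,i')$ is the order of $s_is_{i'}$. The Coxeter graph $\Gamma_W$ has vertex set $I$, with distinct $i,i'$ joined by an edge labeled $m(i,i')$ whenever $m(i,i')\ge 3$. Folding: let $\sigma\colon I\to I$ be an automorphism of the edge-labeled graph $\Gamma_W$ such that each orbit (cycle) of $\sigma$ is an independent set (pairwise nonadjacent vertices) of $\Gamma_W$. Let $I'$ be the set of orbits of $\sigma$. The folding of $W$ along $\sigma$ is the Coxeter group $W'$ with Coxeter system $(W',S')$, $S'=\{s_{\mathfrak o}:\mathfrak o\in I'\}$, where for all $\mathfrak o,\mathfrak o'\in I'$ the order $m(\mathfrak o,\mathfrak o')$ of $s_{\mathfrak o}s_{\mathfrak o'}$ in $W'$ is defined to be the order of $\prod_{i\in\mathfrak o}s_i\prod_{i'\in\mathfrak o'}s_{i'}$ in $W$. The root space is $V=\mathbb R^I$ with standard basis the simple roots $\{\alpha_i:i\in I\}$ and symmetric bilinear form $B(\alpha_i,\alpha_{i'})=-\cos(\pi/m(i,i'))$ (and $-1$ if $m(i,i')=\infty$). $W$ acts on $V$ by $s_i\beta=\beta-2B(\beta,\alpha_i)\alpha_i$. The root system is $\Phi=\{w\alpha_i:w\in W,i\in I\}=\Phi^+\sqcup\Phi^-$, where $\Phi^+$ are the roots that are nonnegative combinations of simple roots and $\Phi^-=-\Phi^+$. For $\beta\in\Phi$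 the half-space $H_\beta^+$ is $\{w\in W:w\beta\in\Phi^+\}$. A subset of $W$ is convex if it is an intersection of half-spaces (the empty intersection being $W$). For a nonempty convex set $\mathscr L\subseteq W$ let $\mathrm R(\mathscr L)=\{\beta\in\Phi:\mathscr L\subseteq H_\beta^+\}$. For $i\in I$, the toggle $\tau_i\colon W\to W$ is defined by $\tau_i(u)=u$ if $u^{-1}\alpha_i\in\mathrm R(\mathscr L)$ and $\tau_i(u)=s_iu$ otherwise. A Coxeter element is a product $c=s_{i_n}\cdots s_{i_1}$ where $i_1,\ldots,i_n$ is an ordering of $I$ (each element once); $\mathrm{Pro}_c=\tau_{i_n}\cdots\tau_{i_1}$ (composition), which depends only on $c$ and $\mathscr L$. The set $\mathscr L$ is heavy with respect to $c$ if every periodic point of $\mathrm{Pro}_c$ (i.e. every $u\in W$ with $\mathrm{Pro}_c^K(u)=u$ for some $K\ge 1$) lies in $\mathscr L$. The Coxeter group $W$ is futuristic if every nonempty convex subset of $W$ is heavy with respect to every Coxeter element of $W$. *)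

theory Defs
  imports
    Complex_Main
    "HOL-Algebra.Multiplicative_Group"
    "HOL-Combinatorics.Orbits"
begin

section \<open>Coxeter systems\<close>

text \<open>
  \<^term>\<open>group.ord\<close> is \<open>0\<close> on elements of infinite order, so throughout
  \<open>cox_m G s i j = 0\<close> stands for \<open>m(i,j) = \<infinity>\<close>.
\<close>

definition cox_m :: "('g, 'b) monoid_scheme \<Rightarrow> ('i \<Rightarrow> 'g) \<Rightarrow> 'i \<Rightarrow> 'i \<Rightarrow> nat" where
  "cox_m G s i j = group.ord G (s i \<otimes>\<^bsub>G\<^esub> s j)"

definition word :: "('g, 'b) monoid_scheme \<Rightarrow> ('i \<Rightarrow> 'g) \<Rightarrow> 'i list \<Rightarrow> 'g" where
  "word G s xs = foldr (\<lambda>i g. s i \<otimes>\<^bsub>G\<^esub> g) xs \<one>\<^bsub>G\<^esub>"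

text \<open>
  Deletion, inside a word, of a relator \<open>(s\<^sub>i s\<^sub>j)\<^bsup>m(i,j)\<^esup>\<close>. If \<open>m(i,j) = \<infinity>\<close> the relator is the
  empty word, so nothing is imposed.
\<close>

inductive cox_step :: "('i \<Rightarrow> 'i \<Rightarrow> nat) \<Rightarrow> 'i set \<Rightarrow> 'i list \<Rightarrow> 'i list \<Rightarrow> bool" for m I where
  "i \<in> I \<Longrightarrow> j \<in> I \<Longrightarrow>
     cox_step m I (xs @ concat (replicate (m i j) [i, j]) @ ys) (xs @ ys)"

text \<open>
  \<open>W\<close> has the presentation \<open>\<langle>s\<^sub>i (i \<in> I) | (s\<^sub>i s\<^sub>j)\<^bsup>m(i,j)\<^esup> = 1 whenever m(i,j) < \<infinity>\<rangle>\<close>, where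
  \<open>m(i,j)\<close> is the order of \<open>s\<^sub>i s\<^sub>j\<close>. Since \<open>m(i,i) = 1\<close>, the relators include \<open>s\<^sub>i s\<^sub>i\<close>; hence
  inverses of generators are not needed, and the group presentation amounts to a monoid
  presentation: the words trivial in \<open>W\<close> are those congruent to the empty word. That
  congruence is the equivalence generated by \<^const>\<open>cox_step\<close>.
\<close>

locale coxeter_system = group W for W (structure) +
  fixes I :: "'i set" and s :: "'i \<Rightarrow> 'a"
  assumes finite_I: "finite I"
    and gen_closed: "s ` I \<subseteq> carrier W"
    and gen_inj: "inj_on s I"
    and gen_involution: "i \<in> I \<Longrightarrow> s i \<otimes> s i = \<one>"
    and generated: "generate W (s ` I) = carrier W"
    and presented: "xs \<in> lists I \<Longrightarrow> word W s xs = \<one> \<Longrightarrow> equivclp (cox_step (cox_m W s) I) xs []"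
begin

abbreviation m :: "'i \<Rightarrow> 'i \<Rightarrow> nat" where
  "m \<equiv> cox_m W s"

definition adjacent :: "'i \<Rightarrow> 'i \<Rightarrow> bool" where
  "adjacent i j \<longleftrightarrow> i \<in> I \<and> j \<in> I \<and> i \<noteq> j \<and> (m i j \<ge> 3 \<or> m i j = 0)"

section \<open>The root system\<close>

text \<open>Vectors of \<open>\<real>\<^sup>I\<close> are functions on the whole index type that vanish outside \<open>I\<close>.\<close>

definition simple_root :: "'i \<Rightarrow> 'i \<Rightarrow> real" where
  "simple_root i = (\<lambda>j. if j = i then 1 else 0)"

definition gram :: "'i \<Rightarrow> 'i \<Rightarrow> real" where
  "gram i j = (if m i j = 0 then - 1 else - cos (pi / real (m i j)))"

definition B :: "('i \<Rightarrow> real) \<Rightarrow> ('i \<Rightarrow> real) \<Rightarrow> real" where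
  "B x y = (\<Sum>i\<in>I. \<Sum>j\<in>I. x i * y j * gram i j)"

definition reflect :: "'i \<Rightarrow> ('i \<Rightarrow> real) \<Rightarrow> ('i \<Rightarrow> real)" where
  "reflect i \<beta> = (\<lambda>j. \<beta> j - 2 * B \<beta> (simple_root i) * simple_root i j)"

text \<open>
  The simple reflections satisfy the defining relations of \<open>W\<close> on \<open>\<real>\<^sup>I\<close>, so the result does
  not depend on the word chosen to represent \<open>w\<close>.
\<close>

definition act :: "'a \<Rightarrow> ('i \<Rightarrow> real) \<Rightarrow> ('i \<Rightarrow> real)" where
  "act w \<beta> = foldr reflect (SOME xs. xs \<in> lists I \<and> word W s xs = w) \<beta>"

definition roots :: "('i \<Rightarrow> real) set" where
  "roots = {act w (simple_root i) | w i. w \<in> carrier W \<and> i \<in> I}"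

definition pos_roots :: "('i \<Rightarrow> real) set" where
  "pos_roots = {\<beta> \<in> roots. \<forall>i\<in>I. \<beta> i \<ge> 0}"

section \<open>Convex sets and Bender--Knuth toggles\<close>

definition half_space :: "('i \<Rightarrow> real) \<Rightarrow> 'a set" where
  "half_space \<beta> = {w \<in> carrier W. act w \<beta> \<in> pos_roots}"

definition convex :: "'a set \<Rightarrow> bool" where
  "convex L \<longleftrightarrow> (\<exists>R\<subseteq>roots. L = carrier W \<inter> (\<Inter>\<beta>\<in>R. half_space \<beta>))"

definition R :: "'a set \<Rightarrow> ('i \<Rightarrow> real) set" where
  "R L = {\<beta> \<in> roots. L \<subseteq> half_space \<beta>}"

definition toggle :: "'a set \<Rightarrow> 'i \<Rightarrow> 'a \<Rightarrow> 'a" where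
  "toggle L i u = (if act (inv u) (simple_root i) \<in> R L then u else s i \<otimes> u)"

text \<open>
  An ordering \<open>i\<^sub>1, \<dots>, i\<^sub>n\<close> of \<open>I\<close> is given by the list \<open>[i\<^sub>n, \<dots>, i\<^sub>1]\<close>, i.e. in the order in
  which the indices occur in \<open>c = s\<^bsub>i\<^sub>n\<^esub> \<cdots> s\<^bsub>i\<^sub>1\<^esub>\<close>.
\<close>

definition orderings :: "'i list set" where
  "orderings = {xs. distinct xs \<and> set xs = I}"

definition coxeter_elements :: "'a set" where
  "coxeter_elements = word W s ` orderings"

definition Pro :: "'a set \<Rightarrow> 'i list \<Rightarrow> 'a \<Rightarrow> 'a" where
  "Pro L xs = foldr (toggle L) xs"

text \<open>
  All orderings of \<open>I\<close> with product \<open>c\<close> induce the same map \<^const>\<open>Pro\<close>, so it is immaterial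
  that the following definition ranges over all of them.
\<close>

definition heavy :: "'a set \<Rightarrow> 'a \<Rightarrow> bool" where
  "heavy L c \<longleftrightarrow> (\<forall>xs\<in>orderings. word W s xs = c \<longrightarrow>
     (\<forall>u\<in>carrier W. (\<exists>K\<ge>1. (Pro L xs ^^ K) u = u) \<longrightarrow> u \<in> L))"

definition futuristic :: bool where
  "futuristic \<longleftrightarrow> (\<forall>L. L \<noteq> {} \<and> convex L \<longrightarrow> (\<forall>c\<in>coxeter_elements. heavy L c))"

section \<open>Foldings\<close>

definition graph_automorphism :: "('i \<Rightarrow> 'i) \<Rightarrow> bool" where
  "graph_automorphism \<sigma> \<longleftrightarrow> bij_betw \<sigma> I I \<and>
     (\<forall>i\<in>I. \<forall>j\<in>I. adjacent (\<sigma> i) (\<sigma> j) \<longleftrightarrow> adjacent i j) \<and>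
     (\<forall>i\<in>I. \<forall>j\<in>I. adjacent i j \<longrightarrow> m (\<sigma> i) (\<sigma> j) = m i j)"

definition orbits :: "('i \<Rightarrow> 'i) \<Rightarrow> 'i set set" where
  "orbits \<sigma> = orbit \<sigma> ` I"

text \<open>
  On a set of pairwise nonadjacent indices the generators commute, so the order of the factors
  is immaterial.
\<close>

definition set_prod :: "'i set \<Rightarrow> 'a" where
  "set_prod A = word W s (SOME xs. distinct xs \<and> set xs = A)"

definition folding ::
  "('i \<Rightarrow> 'i) \<Rightarrow> ('h, 'c) monoid_scheme \<Rightarrow> ('i set \<Rightarrow> 'h) \<Rightarrow> bool" where
  "folding \<sigma> W' s' \<longleftrightarrow>
     graph_automorphism \<sigma> \<and>
     (\<forall>A\<in>orbits \<sigma>. \<forall>i\<in>A. \<forall>j\<in>A. \<not> adjacent i j) \<and>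
     coxeter_system W' (orbits \<sigma>) s' \<and>
     (\<forall>A\<in>orbits \<sigma>. \<forall>A'\<in>orbits \<sigma>. cox_m W' s' A A' = ord (set_prod A \<otimes> set_prod A'))"

end

end

theory Submission
  imports Defs
begin

text \<open>
  Let \<open>\<phi> : W' \<rightarrow> W\<close> send \<open>s\<^sub>A\<close> to \<open>\<Prod>\<^bsub>i\<in>A\<^esub> s\<^sub>i\<close>. For \<open>u \<in> W'\<close> and \<open>i \<in> A\<close> the roots \<open>u \<alpha>\<^sub>A\<close> of \<open>W'\<close> and
  \<open>\<phi>(u) \<alpha>\<^sub>i\<close> of \<open>W\<close> have the same sign. Given a convex set \<open>L \<subseteq> W'\<close>, intersect the half-spaces of \<open>W\<close>
  belonging to all \<open>\<phi>(u) \<alpha>\<^sub>i\<close> with \<open>i \<in> A\<close> and \<open>u \<alpha>\<^sub>A \<in> R(L)\<close>. This convex set meets \<open>\<phi>(W')\<close> exactly in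
  \<open>\<phi>(L)\<close>, and toggling all \<open>i \<in> A\<close> on \<open>\<phi>(u)\<close> amounts to toggling \<open>A\<close> on \<open>u\<close>. Hence \<open>\<phi>\<close> maps periodic
  points of promotion to periodic points, and heaviness descends from \<open>W\<close> to \<open>W'\<close>.

  Both the classical fact that \<open>w \<alpha>\<^sub>i\<close> is positive whenever \<open>\<ell>(w s\<^sub>i) \<ge> \<ell>(w)\<close> and its analogue for
  \<open>\<phi>(u) \<alpha>\<^sub>i\<close> are reduced to rank two by stripping a maximal alternating word off the right end of \<open>w\<close>.
\<close>

section \<open>Alternating words in two letters\<close>

fun alt :: "nat \<Rightarrow> 'a \<Rightarrow> 'a \<Rightarrow> 'a list" where
  "alt 0 a b = []"
| "alt (Suc n) a b = alt n b a @ [a]"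

lemma length_alt [simp]: "length (alt n a b) = n"
  by (induction n a b rule: alt.induct) auto

lemma set_alt: "set (alt n a b) \<subseteq> {a, b}"
  by (induction n a b rule: alt.induct) auto

text \<open>The recursion of \<open>alt\<close> fixes the last letter. Inductions over
  \<open>foldr\<close> work at the other end, where the new letter depends on the parity of the
  length.\<close>

lemma alt_Cons: "alt (Suc n) a b = (if even n then a else b) # alt n a b"
  by (induction n a b rule: alt.induct) auto

lemma alt_add_append:
  "\<exists>ys. alt (k + n) a b = ys @ alt n a b \<and> length ys = k \<and> set ys \<subseteq> {a, b}"
proof (induction k)
  case (Suc k)
  then obtain ys where "alt (k + n) a b = ys @ alt n a b" "length ys = k" "set ys \<subseteq> {a, b}"
    by blast
  then show ?case
    by (intro exI[of _ "(if even (k + n) then a else b) # ys"]) (simp only: add_Suc alt_Cons, auto)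
qed simp

lemma concat_replicate_shift:
  "a # concat (replicate n [b, a]) @ [b] = concat (replicate (Suc n) [a, b])"
  by (induction n) auto

text \<open>The two halves meet in different letters, so the alternation continues across the
  junction. For involutions this translates between agreement of the two alternating words of length
  \<open>n\<close> and triviality of the \<open>n\<close>-th power of a product; both directions are
  used below.\<close>

lemma rev_alt_append_alt: "rev (alt n a b) @ alt n b a = concat (replicate n [a, b])"
proof (induction n arbitrary: a b)
  case (Suc n)
  then show ?case
    using concat_replicate_shift[of a n b] by (simp flip: append_assoc)
qed simp

lemma alt_double: "alt (2 * n) b a = concat (replicate n [a, b])"
proof (induction n)
  case (Suc n)
  have "alt (2 * Suc n) b a = [a, b] @ alt (2 * n) b a"
    by (simp add: alt_Cons del: alt.simps)
  with Suc show ?case by simp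
qed simp

lemma foldr_involutions_rev:
  assumes "\<And>i x. i \<in> set xs \<Longrightarrow> f i (f i x) = x"
  shows "foldr f (rev xs) (foldr f xs x) = x" "foldr f xs (foldr f (rev xs) x) = x"
  using assms by (induction xs arbitrary: x) auto

lemma foldr_concat_replicate_pair:
  "foldr f (concat (replicate n [a, b])) = (f a \<circ> f b) ^^ n"
  by (induction n) (auto simp: fun_eq_iff)

section \<open>Words and the presentation of \<open>W\<close>\<close>

context coxeter_system
begin

lemma s_closed [simp]: "i \<in> I \<Longrightarrow> s i \<in> carrier W"
  using gen_closed by auto

lemma word_Nil [simp]: "word W s [] = \<one>"
  by (simp add: word_def)

lemma word_Cons [simp]: "word W s (i # xs) = s i \<otimes> word W s xs"
  by (simp add: word_def)

lemma word_closed [simp]: "set xs \<subseteq> I \<Longrightarrow> word W s xs \<in> carrier W"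
  by (induction xs) auto

lemma word_append [simp]:
  "set xs \<subseteq> I \<Longrightarrow> set ys \<subseteq> I \<Longrightarrow> word W s (xs @ ys) = word W s xs \<otimes> word W s ys"
  by (induction xs) (auto simp: m_assoc)

lemma inv_s [simp]: "i \<in> I \<Longrightarrow> inv (s i) = s i"
  by (simp add: gen_involution inv_equality)

lemma word_rev: "set xs \<subseteq> I \<Longrightarrow> word W s (rev xs) = inv (word W s xs)"
  by (induction xs) (auto simp: inv_mult_group)

lemma ex_word:
  assumes "w \<in> carrier W"
  shows "\<exists>xs. set xs \<subseteq> I \<and> word W s xs = w"
proof -
  have "w \<in> generate W (s ` I)"
    using assms generated by simp
  then show ?thesis
  proof (induction rule: generate.induct)
    case one
    then show ?case by (intro exI[of _ "[]"]) simp
  next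
    case (incl h)
    then obtain i where "i \<in> I" "h = s i" by auto
    then show ?case by (intro exI[of _ "[i]"]) simp
  next
    case (inv h)
    then obtain i where "i \<in> I" "h = s i" by auto
    then show ?case by (intro exI[of _ "[i]"]) simp
  next
    case (eng h1 h2)
    then obtain xs ys where "set xs \<subseteq> I" "word W s xs = h1" "set ys \<subseteq> I" "word W s ys = h2"
      by auto
    then show ?case by (intro exI[of _ "xs @ ys"]) simp
  qed
qed

lemma word_concat_replicate_pair:
  "set xs \<subseteq> I \<Longrightarrow> set ys \<subseteq> I \<Longrightarrow>
    word W s (concat (replicate n (xs @ ys))) = (word W s xs \<otimes> word W s ys) [^] n"
proof (induction n)
  case (Suc n)
  have "set (concat (replicate n (xs @ ys))) \<subseteq> I"
    using Suc.prems by (cases n) auto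
  then have "word W s (concat (replicate (Suc n) (xs @ ys))) =
      (word W s xs \<otimes> word W s ys) \<otimes> (word W s xs \<otimes> word W s ys) [^] n"
    using Suc by (simp add: m_assoc)
  then show ?case
    using Suc.prems by (simp only: nat_pow_Suc2 m_closed word_closed)
qed simp

lemma word_concat_replicate_eq_one_iff:
  assumes "i \<in> I" "j \<in> I"
  shows "word W s (concat (replicate n [i, j])) = \<one> \<longleftrightarrow> m i j dvd n"
  using word_concat_replicate_pair[of "[i]" "[j]" n] assms
  by (simp add: cox_m_def pow_eq_id)

lemma m_self: "i \<in> I \<Longrightarrow> m i i = 1"
  by (simp add: cox_m_def gen_involution)

lemma m_eq_1_iff: "i \<in> I \<Longrightarrow> j \<in> I \<Longrightarrow> m i j = 1 \<longleftrightarrow> i = j"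
proof
  assume "i \<in> I" "j \<in> I" "m i j = 1"
  then have "s i \<otimes> s j = \<one>"
    using ord_eq_1[of "s i \<otimes> s j"] by (simp add: cox_m_def)
  then have "s i = s j"
    using \<open>i \<in> I\<close> \<open>j \<in> I\<close> inv_equality[of "s i" "s j"] by simp
  then show "i = j"
    using gen_inj \<open>i \<in> I\<close> \<open>j \<in> I\<close> by (auto dest: inj_onD)
qed (simp add: m_self)

lemma m_sym: "i \<in> I \<Longrightarrow> j \<in> I \<Longrightarrow> m i j = m j i"
proof -
  assume "i \<in> I" "j \<in> I"
  then have "s j \<otimes> s i = inv (s i \<otimes> s j)"
    by (simp add: inv_mult_group)
  with \<open>i \<in> I\<close> \<open>j \<in> I\<close> show ?thesis
    by (simp add: cox_m_def ord_inv)
qed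

lemma word_alt_m_swap:
  assumes "i \<in> I" "j \<in> I"
  shows "word W s (alt (m i j) i j) = word W s (alt (m i j) j i)"
proof -
  have sub: "set (alt n i j) \<subseteq> I" "set (alt n j i) \<subseteq> I" for n
    using set_alt[of n i j] set_alt[of n j i] assms by auto
  have "word W s (rev (alt (m i j) i j) @ alt (m i j) j i) = \<one>"
    using assms by (simp only: rev_alt_append_alt word_concat_replicate_eq_one_iff dvd_refl)
  then have "inv (word W s (alt (m i j) i j)) \<otimes> word W s (alt (m i j) j i) = \<one>"
    using sub by (simp add: word_rev)
  then show ?thesis
    using sub by (metis inv_closed inv_equality inv_inv word_closed)
qed

text \<open>Universal property of the presentation, for actions on an arbitrary set. It yields the
  reflection action of \<open>W\<close> and, applied to \<open>W'\<close>, the well-definedness of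
  \<open>emb\<close>.\<close>

lemma word_eq_imp_foldr_eq:
  assumes inv2: "\<And>i x. i \<in> I \<Longrightarrow> f i (f i x) = x"
    and rel: "\<And>i j x. i \<in> I \<Longrightarrow> j \<in> I \<Longrightarrow> foldr f (concat (replicate (m i j) [i, j])) x = x"
    and xs: "set xs \<subseteq> I" and ys: "set ys \<subseteq> I" and eq: "word W s xs = word W s ys"
  shows "foldr f xs = foldr f ys"
proof -
  have step: "foldr f us = foldr f vs" if "cox_step m I us vs" for us vs
    using that by cases (auto simp: fun_eq_iff rel)
  \<comment> \<open>\<open>presented\<close> speaks of words with product one; reversing a word
    inverts its product.\<close>
  have "word W s (xs @ rev ys) = \<one>"
    using xs ys eq by (simp add: word_rev)
  then have "equivclp (cox_step m I) (xs @ rev ys) []"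
    using presented[of "xs @ rev ys"] xs ys by (simp add: lists_eq_set)
  then have "foldr f (xs @ rev ys) = foldr f []"
    by (induction rule: equivclp_induct) (auto dest: step)
  then have "foldr f xs (foldr f (rev ys) (foldr f ys x)) = foldr f ys x" for x
    by (auto simp: fun_eq_iff)
  moreover have "foldr f (rev ys) (foldr f ys x) = x" for x
    using ys inv2 by (intro foldr_involutions_rev) auto
  ultimately show ?thesis
    by (auto simp: fun_eq_iff)
qed

subsection \<open>The geometric representation\<close>

lemma simple_root_eq_iff [simp]: "simple_root i = simple_root j \<longleftrightarrow> i = j"
proof
  assume "simple_root i = simple_root j"
  then have "simple_root i i = simple_root j i" by simp
  then show "i = j" by (simp add: simple_root_def split: if_splits)
qed simp

lemma B_simple_root: "i \<in> I \<Longrightarrow> B \<beta> (simple_root i) = (\<Sum>k\<in>I. \<beta> k * gram k i)"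
  unfolding B_def simple_root_def using finite_I
  by (intro sum.cong refl) (simp add: if_distrib[of "\<lambda>x. _ * x * _"] if_distrib[of "\<lambda>x. x * _"] cong: if_cong)

lemma B_lin_left: "B (\<lambda>k. a * x k + b * y k) z = a * B x z + b * B y z"
  by (simp add: B_def sum.distrib sum_distrib_left algebra_simps)

lemma gram_sym: "i \<in> I \<Longrightarrow> j \<in> I \<Longrightarrow> gram i j = gram j i"
  using m_sym by (simp add: gram_def)

lemma gram_self: "i \<in> I \<Longrightarrow> gram i i = 1"
  using m_self by (simp add: gram_def)

lemma B_sym: "B x y = B y x"
  unfolding B_def by (subst sum.swap) (auto intro!: sum.cong simp: gram_sym)

lemma B_lin_right: "B z (\<lambda>k. a * x k + b * y k) = a * B z x + b * B z y"
  using B_lin_left B_sym by metis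

lemma B_simple_simple: "i \<in> I \<Longrightarrow> j \<in> I \<Longrightarrow> B (simple_root i) (simple_root j) = gram i j"
  using finite_I by (simp add: B_simple_root) (simp add: simple_root_def if_distrib[of "\<lambda>x. x * _"] cong: if_cong)

text \<open>The coefficient 1 is spelled out so that the right-hand side matches the linear
  combinations in \<open>B_lin_left\<close>, \<open>B_lin_right\<close> and
  \<open>foldr_reflect_lin\<close>.\<close>

lemma reflect_alt_def:
  "reflect i \<beta> = (\<lambda>k. 1 * \<beta> k + (- 2 * B \<beta> (simple_root i)) * simple_root i k)"
  by (simp add: reflect_def)

lemma reflect_apply: "reflect i \<beta> k = (if k = i then \<beta> i - 2 * B \<beta> (simple_root i) else \<beta> k)"
  by (simp add: reflect_def simple_root_def)

lemma reflect_lin: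
  "reflect i (\<lambda>k. a * x k + b * y k) = (\<lambda>k. a * reflect i x k + b * reflect i y k)"
  by (simp add: reflect_def B_lin_left algebra_simps)

lemma foldr_reflect_lin:
  "foldr reflect xs (\<lambda>k. a * x k + b * y k) = (\<lambda>k. a * foldr reflect xs x k + b * foldr reflect xs y k)"
  by (induction xs) (simp_all add: reflect_lin)

lemma B_reflect:
  assumes "i \<in> I"
  shows "B (reflect i x) (reflect i y) = B x y"
  using assms B_sym[of "simple_root i" y]
  by (simp only: reflect_alt_def B_lin_left B_lin_right B_simple_simple gram_self)
    (simp add: algebra_simps)

lemma B_foldr_reflect: "set xs \<subseteq> I \<Longrightarrow> B (foldr reflect xs x) (foldr reflect xs y) = B x y"
  by (induction xs) (auto simp: B_reflect)

lemma B_reflect_simple: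
  assumes "i \<in> I"
  shows "B (reflect i x) (simple_root i) = - B x (simple_root i)"
  using assms by (simp only: reflect_alt_def B_lin_left B_simple_simple gram_self)

lemma reflect_reflect: "i \<in> I \<Longrightarrow> reflect i (reflect i x) = x"
  by (auto simp: fun_eq_iff reflect_apply B_reflect_simple)

lemma reflect_simple_self: "i \<in> I \<Longrightarrow> reflect i (simple_root i) = (\<lambda>k. - simple_root i k)"
  by (simp add: reflect_def B_simple_simple gram_self fun_eq_iff)

lemma reflect_two:
  assumes "i \<in> I" "j \<in> I" "i \<noteq> j"
  shows "reflect i (\<lambda>k. p * simple_root i k + q * simple_root j k) =
    (\<lambda>k. (- 2 * gram i j * q - p) * simple_root i k + q * simple_root j k)"
  using assms gram_sym[of i j]
  by (simp only: reflect_alt_def B_lin_left B_simple_simple gram_self)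
    (auto simp: algebra_simps fun_eq_iff)

text \<open>The Chebyshev value \<open>U\<^bsub>n-1\<^esub>(cos (\<pi>/m(i,j)))\<close>, with its limit for \<open>m(i,j) = \<infinity>\<close>.\<close>

definition cheb :: "'i \<Rightarrow> 'i \<Rightarrow> nat \<Rightarrow> real" where
  "cheb i j n = (if m i j = 0 then real n else sin (real n * pi / m i j) / sin (pi / m i j))"

lemma sin_pi_div_pos:
  assumes "i \<in> I" "j \<in> I" "i \<noteq> j" "m i j \<noteq> 0"
  shows "sin (pi / m i j) > 0"
proof -
  have "m i j \<ge> 2"
    using m_eq_1_iff[of i j] assms by linarith
  then have "pi / m i j < pi"
    by (simp add: divide_less_eq)
  then show ?thesis
    using assms(4) by (intro sin_gt_zero) auto
qed

text \<open>For finite \<open>m i j\<close> this is the addition theorem for the sine, since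
  \<open>gram i j\<close> is minus the cosine of the angle; in the limit case it reads n + 2 = 2(n +
  1) - n.\<close>

lemma cheb_rec:
  assumes "i \<in> I" "j \<in> I" "i \<noteq> j"
  shows "cheb i j (Suc (Suc n)) = - 2 * gram i j * cheb i j (Suc n) - cheb i j n"
proof (cases "m i j = 0")
  case False
  let ?t = "pi / m i j"
  have "sin ((real n + 1) * ?t + ?t) + sin ((real n + 1) * ?t - ?t) = 2 * cos ?t * sin ((real n + 1) * ?t)"
    by (simp only: sin_add sin_diff) simp
  moreover have "(real n + 1) * ?t + ?t = (real n + 2) * ?t" "(real n + 1) * ?t - ?t = real n * ?t"
    by (simp_all add: algebra_simps add_divide_distrib)
  ultimately have "sin ((real n + 2) * ?t) = 2 * cos ?t * sin ((real n + 1) * ?t) - sin (real n * ?t)"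
    by simp
  then show ?thesis
    using False sin_pi_div_pos[OF assms False]
    by (simp add: cheb_def gram_def field_simps)
qed (simp add: cheb_def gram_def)

lemma cheb_0 [simp]: "cheb i j 0 = 0"
  by (simp add: cheb_def)

lemma cheb_1:
  assumes "i \<in> I" "j \<in> I" "i \<noteq> j"
  shows "cheb i j (Suc 0) = 1"
  using sin_pi_div_pos[OF assms] by (cases "m i j = 0") (auto simp: cheb_def)

lemma cheb_nonneg:
  assumes "i \<in> I" "j \<in> I" "i \<noteq> j" "m i j = 0 \<or> n \<le> m i j"
  shows "cheb i j n \<ge> 0"
proof (cases "m i j = 0")
  case False
  then have "real n * pi / m i j \<le> pi"
    using assms(4) by (simp add: divide_le_eq)
  then have "sin (real n * pi / m i j) \<ge> 0"
    by (intro sin_ge_zero) auto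
  then show ?thesis
    using sin_pi_div_pos[OF assms(1-3) False] False by (simp add: cheb_def)
qed (simp add: cheb_def)

text \<open>Each reflection changes just one of the two coefficients, and by exactly the Chebyshev
  recursion; the parity of \<open>n\<close> tells which one was changed last.\<close>

lemma foldr_reflect_alt_simple:
  assumes "i \<in> I" "j \<in> I" "i \<noteq> j"
  shows "foldr reflect (alt n j i) (simple_root i) =
    (if even n then (\<lambda>k. cheb i j (Suc n) * simple_root i k + cheb i j n * simple_root j k)
     else (\<lambda>k. cheb i j n * simple_root i k + cheb i j (Suc n) * simple_root j k))"
proof (induction n)
  case 0
  then show ?case using cheb_1[OF assms] by simp
next
  case (Suc n)
  have swap: "reflect j (\<lambda>k. p * simple_root i k + q * simple_root j k) =
    (\<lambda>k. p * simple_root i k + (- 2 * gram i j * p - q) * simple_root j k)" for p q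
    using reflect_two[of j i q p] assms gram_sym[of i j] by (simp add: add.commute)
  show ?case
    unfolding alt_Cons using Suc assms
    by (auto simp add: reflect_two swap cheb_rec simp del: alt.simps)
qed

lemma reflect_orthogonal: "B x (simple_root i) = 0 \<Longrightarrow> reflect i x = x"
  by (simp add: reflect_def)

lemma foldr_reflect_braid_simple:
  assumes "i \<in> I" "j \<in> I" "i \<noteq> j" "m i j \<noteq> 0"
  shows "foldr reflect (concat (replicate (m i j) [i, j])) (simple_root i) = simple_root i"
proof -
  \<comment> \<open>The relator has length \<open>2 * m i j\<close>, which advances the angle by a
    full turn.\<close>
  have eq1: "real (Suc (2 * m i j)) * pi / m i j = pi / m i j + 2 * pi"
    and eq2: "real (2 * m i j) * pi / m i j = 2 * pi"
    using assms(4) by (simp_all add: field_simps)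
  have "cheb i j (Suc (2 * m i j)) = 1" "cheb i j (2 * m i j) = 0"
    using assms(4) sin_pi_div_pos[OF assms] unfolding cheb_def eq1 eq2 by simp_all
  then show ?thesis
    using foldr_reflect_alt_simple[OF assms(1-3), of "2 * m i j"] by (simp add: alt_double)
qed

text \<open>For distinct indices and finite \<open>m i j\<close> the form is nondegenerate on the
  plane of the two simple roots. So \<open>x\<close> splits into a part in this plane, settled by
  the values on the two roots, and an orthogonal part fixed by both reflections.\<close>

lemma foldr_reflect_braid:
  assumes ij: "i \<in> I" "j \<in> I"
  shows "foldr reflect (concat (replicate (m i j) [i, j])) x = x"
proof (cases "i = j \<or> m i j = 0")
  case True
  then show ?thesis
    using m_self[OF ij(1)] reflect_reflect[OF ij(1)] by auto
next
  case False
  then have ne: "i \<noteq> j" and nz: "m i j \<noteq> 0" by auto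
  let ?M = "foldr reflect (concat (replicate (m i j) [i, j]))"
  let ?N = "foldr reflect (concat (replicate (m i j) [j, i]))"
  have Mi: "?M (simple_root i) = simple_root i"
    by (rule foldr_reflect_braid_simple[OF ij ne nz])
  have rev: "rev (concat (replicate n [i, j])) = concat (replicate n [j, i])" for n
    by (simp add: rev_concat)
  \<comment> \<open>The word of \<open>?M\<close> is the reverse of that of \<open>?N\<close>, so
    the two maps are inverse to each other. The previous lemma with the indices exchanged says that
    \<open>?N\<close> fixes \<open>simple_root j\<close>; hence so does \<open>?M\<close>.\<close>
  have "?M (?N (simple_root j)) = simple_root j"
    unfolding rev[symmetric] by (rule foldr_involutions_rev) (use ij reflect_reflect in \<open>auto split: if_splits\<close>)
  then have Mj: "?M (simple_root j) = simple_root j"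
    using foldr_reflect_braid_simple[of j i] ij ne nz m_sym[OF ij] by simp
  let ?bi = "B x (simple_root i)" and ?bj = "B x (simple_root j)" and ?g = "gram i j"
  \<comment> \<open>Cramer's rule for the coefficients of the orthogonal projection to the
    plane.\<close>
  define p where "p = (?bi - ?g * ?bj) / (1 - ?g\<^sup>2)"
  define q where "q = (?bj - ?g * ?bi) / (1 - ?g\<^sup>2)"
  define y where "y = (\<lambda>k. 1 * x k + (-1) * (p * simple_root i k + q * simple_root j k))"
  have "1 - ?g\<^sup>2 = (sin (pi / m i j))\<^sup>2"
    using nz by (simp add: gram_def cos_squared_eq)
  then have det: "1 - ?g\<^sup>2 \<noteq> 0"
    using sin_pi_div_pos[OF ij ne nz] by simp
  have By: "B y (simple_root k) = B x (simple_root k) - (p * B (simple_root i) (simple_root k)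
      + q * B (simple_root j) (simple_root k))" for k
    unfolding y_def by (simp only: B_lin_left) simp
  have pq: "p + q * ?g = ?bi" "p * ?g + q = ?bj"
    using det unfolding p_def q_def by (simp_all add: divide_simps power2_eq_square) (simp_all add: algebra_simps)
  have y0: "B y (simple_root i) = 0" "B y (simple_root j) = 0"
    using By[of i] By[of j] ij pq gram_sym[OF ij] by (simp_all add: B_simple_simple gram_self)
  have "((reflect i \<circ> reflect j) ^^ n) y = y" for n
    using y0 by (induction n) (auto simp: reflect_orthogonal)
  then have My: "?M y = y"
    by (simp only: foldr_concat_replicate_pair)
  have x: "(\<lambda>k. 1 * y k + 1 * (p * simple_root i k + q * simple_root j k)) = x"
    by (simp add: y_def)
  have "?M (\<lambda>k. 1 * y k + 1 * (p * simple_root i k + q * simple_root j k)) =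
      (\<lambda>k. 1 * y k + 1 * (p * simple_root i k + q * simple_root j k))"
    by (simp only: foldr_reflect_lin My Mi Mj)
  then show ?thesis
    by (simp only: x)
qed

lemma act_word: "set xs \<subseteq> I \<Longrightarrow> act (word W s xs) = foldr reflect xs"
proof -
  assume xs: "set xs \<subseteq> I"
  define ys where "ys = (SOME ys. ys \<in> lists I \<and> word W s ys = word W s xs)"
  have "ys \<in> lists I \<and> word W s ys = word W s xs"
    unfolding ys_def by (rule someI[of _ xs]) (use xs in \<open>simp add: lists_eq_set\<close>)
  then have "foldr reflect ys = foldr reflect xs"
    using word_eq_imp_foldr_eq[of reflect ys xs] xs
    by (simp add: lists_eq_set reflect_reflect foldr_reflect_braid)
  then show ?thesis
    by (simp add: act_def fun_eq_iff ys_def)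
qed

lemma act_one: "act \<one> = id"
  using act_word[of "[]"] by (simp add: id_def fun_eq_iff)

lemma act_mult: "u \<in> carrier W \<Longrightarrow> v \<in> carrier W \<Longrightarrow> act (u \<otimes> v) x = act u (act v x)"
proof -
  assume "u \<in> carrier W" "v \<in> carrier W"
  then obtain xs ys where "set xs \<subseteq> I" "word W s xs = u" "set ys \<subseteq> I" "word W s ys = v"
    using ex_word by meson
  then show ?thesis
    using act_word[of "xs @ ys"] act_word[of xs] act_word[of ys] by simp
qed

lemma act_s: "i \<in> I \<Longrightarrow> act (s i) = reflect i"
  using act_word[of "[i]"] by (simp add: fun_eq_iff)

lemma act_lin:
  "w \<in> carrier W \<Longrightarrow> act w (\<lambda>k. a * x k + b * y k) = (\<lambda>k. a * act w x k + b * act w y k)"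
  using ex_word[of w] foldr_reflect_lin act_word by metis

lemma B_act: "w \<in> carrier W \<Longrightarrow> B (act w x) (act w y) = B x y"
  using ex_word[of w] B_foldr_reflect act_word by metis

lemma act_neg_simple:
  assumes "w \<in> carrier W" "i \<in> I"
  shows "act (w \<otimes> s i) (simple_root i) = (\<lambda>k. - act w (simple_root i) k)"
  using assms act_lin[of w "-1" "simple_root i" 0 "simple_root i"]
  by (simp add: act_mult act_s reflect_simple_self)

lemma act_simple_outside:
  assumes "w \<in> carrier W" "i \<in> I" "k \<notin> I"
  shows "act w (simple_root i) k = 0"
proof -
  obtain xs where xs: "set xs \<subseteq> I" "word W s xs = w"
    using ex_word assms(1) by blast
  then have "foldr reflect xs (simple_root i) k = 0"
    using assms by (induction xs arbitrary: w) (auto simp: reflect_apply simple_root_def)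
  then show ?thesis
    using xs act_word by auto
qed

subsection \<open>Lengths and positivity\<close>

definition len :: "'a \<Rightarrow> nat" where
  "len w = (LEAST n. \<exists>xs. set xs \<subseteq> I \<and> length xs = n \<and> word W s xs = w)"

text \<open>With the weak inequality, failure at \<open>w\<close> is at once an ascent at
  \<open>w \<otimes> s i\<close>; see \<open>not_ascentD\<close>.\<close>

definition ascent :: "'a \<Rightarrow> 'i \<Rightarrow> bool" where
  "ascent w i \<longleftrightarrow> len w \<le> len (w \<otimes> s i)"

lemma len_word_le: "set xs \<subseteq> I \<Longrightarrow> len (word W s xs) \<le> length xs"
  unfolding len_def by (rule Least_le) auto

lemma ex_reduced_word:
  assumes "w \<in> carrier W"
  shows "\<exists>xs. set xs \<subseteq> I \<and> length xs = len w \<and> word W s xs = w"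
proof -
  have "\<exists>n xs. set xs \<subseteq> I \<and> length xs = n \<and> word W s xs = w"
    using ex_word[OF assms] by auto
  then show ?thesis
    unfolding len_def by (rule LeastI_ex)
qed

lemma len_mult_word_le:
  assumes "w \<in> carrier W" "set ys \<subseteq> I"
  shows "len (w \<otimes> word W s ys) \<le> len w + length ys"
proof -
  obtain xs where "set xs \<subseteq> I" "length xs = len w" "word W s xs = w"
    using ex_reduced_word assms(1) by blast
  then show ?thesis
    using len_word_le[of "xs @ ys"] assms by simp
qed

lemma mult_s_s: "w \<in> carrier W \<Longrightarrow> i \<in> I \<Longrightarrow> w \<otimes> s i \<otimes> s i = w"
  by (simp add: m_assoc gen_involution)

lemma not_ascentD:
  assumes "w \<in> carrier W" "i \<in> I" "\<not> ascent w i"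
  shows "ascent (w \<otimes> s i) i"
  using assms by (simp add: ascent_def mult_s_s)

text \<open>Strip off the right end of \<open>w\<close> the longest alternating word ending in
  \<open>j\<close> for which the lengths add up. Maximality makes the letter that would come next an
  ascent of \<open>v\<close>, and additivity of lengths does the same for the letter stripped
  last.\<close>

lemma ex_parabolic_factorization:
  assumes w: "w \<in> carrier W" and ij: "i \<in> I" "j \<in> I" "i \<noteq> j"
    and asc: "ascent w i" and desc: "\<not> ascent w j"
  shows "\<exists>v n. v \<in> carrier W \<and> w = v \<otimes> word W s (alt n j i) \<and> len v < len w \<and>
    ascent v i \<and> ascent v j \<and> (m i j = 0 \<or> n < m i j)"
proof -
  define P where "P n \<longleftrightarrow>
    (\<exists>v. v \<in> carrier W \<and> w = v \<otimes> word W s (alt n j i) \<and> len w = len v + n)" for n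
  define N where "N = (GREATEST n. P n)"
  have sub: "set (alt n j i) \<subseteq> I" "set (alt n i j) \<subseteq> I" for n
    using set_alt[of n j i] set_alt[of n i j] ij by auto
  have bound: "\<And>n. P n \<Longrightarrow> n \<le> len w"
    by (auto simp: P_def)
  have "len w \<le> len (w \<otimes> s j) + 1"
    using len_mult_word_le[of "w \<otimes> s j" "[j]"] w ij by (simp add: mult_s_s)
  then have P1: "P 1"
    unfolding P_def using w ij desc
    by (intro exI[of _ "w \<otimes> s j"]) (auto simp: mult_s_s ascent_def)
  have "P N"
    unfolding N_def by (rule GreatestI_nat[where P = P and b = "len w", OF P1 bound])
  then obtain v where v: "v \<in> carrier W" "w = v \<otimes> word W s (alt N j i)" "len w = len v + N"
    by (auto simp: P_def)
  \<comment> \<open>This makes \<open>v\<close> strictly shorter than \<open>w\<close>, as the later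
    induction on length requires.\<close>
  have "1 \<le> N"
    unfolding N_def by (rule Greatest_le_nat[where P = P and b = "len w", OF P1 bound])
  then obtain N' where N': "N = Suc N'"
    by (cases N) auto
  \<comment> \<open>\<open>a\<close> is the letter that would extend the stripped word to the left;
    \<open>b\<close> is its present leftmost letter.\<close>
  define a b where "a = (if even N then j else i)" and "b = (if even N then i else j)"
  have ab: "a \<in> I" "b \<in> I" "{a, b} = {i, j}"
    using ij by (auto simp: a_def b_def)
  have asc_a: "ascent v a"
  proof (rule ccontr)
    assume *: "\<not> ascent v a"
    have "len v \<le> len (v \<otimes> s a) + 1"
      using len_mult_word_le[of "v \<otimes> s a" "[a]"] v ab by (simp add: mult_s_s)
    moreover have "v \<otimes> s a \<otimes> word W s (alt (Suc N) j i) = w"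
      using v ab sub unfolding alt_Cons a_def[symmetric]
      by (simp add: m_assoc[symmetric] mult_s_s)
    ultimately have "P (Suc N)"
      unfolding P_def using * v ab
      by (intro exI[of _ "v \<otimes> s a"]) (auto simp: ascent_def simp del: alt.simps)
    then have "Suc N \<le> N"
      using Greatest_le_nat[of P "Suc N"] bound unfolding N_def by blast
    then show False by simp
  qed
  have asc_b: "ascent v b"
  proof -
    have "alt N j i = b # alt N' j i"
      unfolding N' alt_Cons by (auto simp: b_def N')
    then have "w = (v \<otimes> s b) \<otimes> word W s (alt N' j i)"
      using v ab sub by (simp add: m_assoc)
    then have "len w \<le> len (v \<otimes> s b) + N'"
      using len_mult_word_le[of "v \<otimes> s b" "alt N' j i"] v ab sub by simp
    then show ?thesis
      using v N' by (simp add: ascent_def)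
  qed
  have "m i j = 0 \<or> N < m i j"
  proof (rule ccontr)
    assume "\<not> ?thesis"
    then have "m i j \<noteq> 0" "m i j \<le> N" by auto
    then obtain k p where k: "N = k + m i j" and p: "m i j = Suc p"
      by (metis add.commute le_Suc_ex not0_implies_Suc)
    obtain ys where ys: "alt N j i = ys @ alt (m i j) j i" "length ys = k" "set ys \<subseteq> I"
      using alt_add_append[of k "m i j" j i] k ij by auto
    \<comment> \<open>The braid relation lets the tail end in \<open>s i\<close>, so multiplying
      \<open>w\<close> by \<open>s i\<close> would shorten it, contrary to the ascent at
      \<open>i\<close>.\<close>
    have "word W s (alt (m i j) j i) = word W s (alt p j i) \<otimes> s i"
      using word_alt_m_swap[OF ij(1,2)] sub ij p by simp
    then have "w = v \<otimes> word W s (ys @ alt p j i) \<otimes> s i"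
      using v ys ij sub by (simp add: m_assoc)
    then have "w \<otimes> s i = v \<otimes> word W s (ys @ alt p j i)"
      using v ys ij sub by (simp add: mult_s_s)
    then have "len (w \<otimes> s i) \<le> len v + (k + p)"
      using len_mult_word_le[of v "ys @ alt p j i"] v ys sub by simp
    then show False
      using asc v k p by (simp add: ascent_def)
  qed
  moreover have "ascent v i" "ascent v j"
    using asc_a asc_b ab by (metis insertE singletonD insertCI)+
  ultimately show ?thesis
    using v N' by (intro exI[of _ v] exI[of _ N]) auto
qed

text \<open>Induction on length: the last letter \<open>j\<close> of a reduced word of
  \<open>w\<close> is a descent, hence differs from \<open>i\<close>, and the factorization applies.
  The rule serves both positivity theorems, the one for \<open>W\<close> and the one along the
  embedding of \<open>W'\<close>.\<close>

lemma ascent_induct [consumes 3, case_names one step]: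
  assumes "w \<in> carrier W" "i \<in> I" "ascent w i"
    and one: "\<And>i. i \<in> I \<Longrightarrow> P \<one> i"
    and step: "\<And>v i j n. v \<in> carrier W \<Longrightarrow> i \<in> I \<Longrightarrow> j \<in> I \<Longrightarrow> i \<noteq> j \<Longrightarrow> P v i \<Longrightarrow> P v j \<Longrightarrow>
      m i j = 0 \<or> n < m i j \<Longrightarrow> P (v \<otimes> word W s (alt n j i)) i"
  shows "P w i"
  using assms(1-3)
proof (induction "len w" arbitrary: w i rule: less_induct)
  case less
  show ?case
  proof (cases "w = \<one>")
    case False
    obtain xs where xs: "set xs \<subseteq> I" "length xs = len w" "word W s xs = w"
      using ex_reduced_word less.prems(1) by blast
    with False have "xs \<noteq> []" by auto
    then obtain ys j where ys: "xs = ys @ [j]"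
      by (metis append_butlast_last_id)
    then have j: "j \<in> I" "set ys \<subseteq> I" and "w \<otimes> s j = word W s ys"
      using xs by (auto simp: mult_s_s)
    then have desc: "\<not> ascent w j"
      using len_word_le[of ys] xs ys by (simp add: ascent_def)
    with less.prems have "i \<noteq> j" by auto
    then obtain v n where v: "v \<in> carrier W" "w = v \<otimes> word W s (alt n j i)" "len v < len w"
      "ascent v i" "ascent v j" "m i j = 0 \<or> n < m i j"
      using ex_parabolic_factorization[OF less.prems(1,2) j(1) _ less.prems(3) desc] by blast
    show ?thesis
      unfolding v(2)
      by (intro step[OF v(1) less.prems(2) j(1) \<open>i \<noteq> j\<close>] less.hyps v less.prems j)
  qed (use one less.prems in auto)
qed

lemma ascent_imp_act_nonneg:
  assumes "w \<in> carrier W" "i \<in> I" "ascent w i" "k \<in> I"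
  shows "0 \<le> act w (simple_root i) k"
proof -
  have "\<forall>k\<in>I. 0 \<le> act w (simple_root i) k"
    using assms(1-3)
  proof (induction rule: ascent_induct)
    case (step v i j n)
    have sub: "set (alt n j i) \<subseteq> I"
      using set_alt[of n j i] step by auto
    \<comment> \<open>If \<open>m i j\<close> is nonzero, \<open>n < m i j\<close> keeps both
      \<open>n\<close> and \<open>Suc n\<close> in the range of \<open>cheb_nonneg\<close>.\<close>
    obtain p q where pq: "p \<ge> 0" "q \<ge> 0" "foldr reflect (alt n j i) (simple_root i) =
        (\<lambda>k. p * simple_root i k + q * simple_root j k)"
      using foldr_reflect_alt_simple[of i j n] cheb_nonneg[of i j n] cheb_nonneg[of i j "Suc n"] step
      by (cases "even n") (auto simp: Suc_le_eq)
    have "act (v \<otimes> word W s (alt n j i)) (simple_root i) =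
        (\<lambda>k. p * act v (simple_root i) k + q * act v (simple_root j) k)"
      using step sub by (simp add: act_mult act_word pq act_lin)
    then show ?case
      using step pq by (simp add: mult_nonneg_nonneg)
  qed (simp add: act_one simple_root_def)
  with assms(4) show ?thesis by blast
qed

lemma not_ascent_imp_act_nonpos:
  assumes "w \<in> carrier W" "i \<in> I" "\<not> ascent w i" "k \<in> I"
  shows "act w (simple_root i) k \<le> 0"
  using ascent_imp_act_nonneg[of "w \<otimes> s i" i k] not_ascentD[of w i] act_neg_simple[of w i] assms
  by simp

text \<open>The form is invariant and takes the value 1 on a simple root, so the image cannot
  vanish. This makes the positive and the negative case exclude each other.\<close>

lemma ex_act_simple_neq_0:
  assumes "w \<in> carrier W" "i \<in> I"
  shows "\<exists>k\<in>I. act w (simple_root i) k \<noteq> 0"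
proof (rule ccontr)
  assume "\<not> ?thesis"
  then have "B (act w (simple_root i)) (act w (simple_root i)) = 0"
    by (simp add: B_def)
  then show False
    using assms by (simp add: B_act B_simple_simple gram_self)
qed

lemma ascent_iff_act_nonneg:
  assumes "w \<in> carrier W" "i \<in> I"
  shows "ascent w i \<longleftrightarrow> (\<forall>k\<in>I. 0 \<le> act w (simple_root i) k)"
  using ascent_imp_act_nonneg[OF assms] not_ascent_imp_act_nonpos[OF assms]
    ex_act_simple_neq_0[OF assms] by (meson order_antisym)

lemma act_simple_in_roots: "w \<in> carrier W \<Longrightarrow> i \<in> I \<Longrightarrow> act w (simple_root i) \<in> roots"
  by (auto simp: roots_def)

lemma act_simple_in_pos_roots_iff:
  "w \<in> carrier W \<Longrightarrow> i \<in> I \<Longrightarrow> act w (simple_root i) \<in> pos_roots \<longleftrightarrow> ascent w i"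
  by (simp add: pos_roots_def act_simple_in_roots ascent_iff_act_nonneg)

text \<open>The last letter \<open>j\<close> of a reduced word of a nontrivial \<open>w\<close> is a
  descent, so \<open>w\<close> makes \<alpha>_j negative instead of fixing it.\<close>

lemma act_faithful:
  assumes w: "w \<in> carrier W" and fixed: "\<And>i. i \<in> I \<Longrightarrow> act w (simple_root i) = simple_root i"
  shows "w = \<one>"
proof (rule ccontr)
  assume "w \<noteq> \<one>"
  obtain xs where xs: "set xs \<subseteq> I" "length xs = len w" "word W s xs = w"
    using ex_reduced_word w by blast
  with \<open>w \<noteq> \<one>\<close> have "xs \<noteq> []" by auto
  then obtain ys j where ys: "xs = ys @ [j]"
    by (metis append_butlast_last_id)
  then have j: "j \<in> I" "set ys \<subseteq> I" and "w \<otimes> s j = word W s ys"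
    using xs by (auto simp: mult_s_s)
  then have "\<not> ascent w j"
    using len_word_le[of ys] xs ys by (simp add: ascent_def)
  then show False
    using w j fixed[of j] by (auto simp: ascent_iff_act_nonneg simple_root_def split: if_splits)
qed

text \<open>By faithfulness, identities in \<open>W\<close> can be checked on vectors; the arguments
  about foldings compare functions in this way.\<close>

lemma word_eq_iff_foldr_reflect_eq:
  assumes "set xs \<subseteq> I" "set ys \<subseteq> I"
  shows "word W s xs = word W s ys \<longleftrightarrow> foldr reflect xs = foldr reflect ys"
proof
  assume eq: "foldr reflect xs = foldr reflect ys"
  have "act (word W s (rev ys @ xs)) \<beta> = \<beta>" for \<beta>
    using assms reflect_reflect eq
    by (subst act_word) (auto intro!: foldr_involutions_rev)
  then have "word W s (rev ys @ xs) = \<one>"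
    using assms by (intro act_faithful) auto
  then have "inv (word W s ys) \<otimes> word W s xs = \<one>"
    using assms by (simp add: word_rev)
  then show "word W s xs = word W s ys"
    using assms by (metis inv_closed inv_equality inv_inv word_closed)
qed (use assms act_word in metis)

text \<open>\<open>reflect j\<close> alters only coordinate \<open>j\<close>. The reflected root has
  a negative coordinate, so all its coordinates are nonpositive, and the unaltered ones, being also
  nonnegative, vanish. A nonnegative multiple of \<alpha>_j of norm 1 is \<alpha>_j.\<close>

lemma nonneg_root_eq_simple:
  assumes w: "w \<in> carrier W" "i \<in> I" and nonneg: "\<And>k. k \<in> I \<Longrightarrow> 0 \<le> act w (simple_root i) k"
    and j: "j \<in> I" "reflect j (act w (simple_root i)) j < 0"
  shows "act w (simple_root i) = simple_root j"
proof -
  let ?\<gamma> = "act w (simple_root i)"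
  have r: "reflect j ?\<gamma> = act (s j \<otimes> w) (simple_root i)"
    using w j by (simp add: act_mult act_s)
  then have "\<not> ascent (s j \<otimes> w) i"
    using w j ascent_iff_act_nonneg[of "s j \<otimes> w" i] by (auto simp: not_le)
  then have "reflect j ?\<gamma> k \<le> 0" if "k \<in> I" for k
    using not_ascent_imp_act_nonpos[of "s j \<otimes> w" i k] w j r that by simp
  then have zero: "?\<gamma> k = 0" if "k \<in> I" "k \<noteq> j" for k
    using nonneg[of k] that by (force simp: reflect_apply)
  \<comment> \<open>The zero summand only gives the shape that the linearity rules expect.\<close>
  have \<gamma>: "?\<gamma> = (\<lambda>k. ?\<gamma> j * simple_root j k + 0 * simple_root j k)"
  proof
    fix k show "?\<gamma> k = ?\<gamma> j * simple_root j k + 0 * simple_root j k"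
      using zero[of k] act_simple_outside[of w i k] w by (auto simp: simple_root_def)
  qed
  have "B ?\<gamma> ?\<gamma> = 1"
    using w by (simp add: B_act B_simple_simple gram_self)
  moreover have "B ?\<gamma> ?\<gamma> = ?\<gamma> j * ?\<gamma> j"
    using j by (subst (1 2) \<gamma>) (simp only: B_lin_left B_lin_right B_simple_simple gram_self, simp)
  ultimately have "?\<gamma> j = 1"
    using nonneg[OF j(1)] by (metis power2_eq_1_iff power2_eq_square neg_0_le_iff_le not_one_le_zero)
  with \<gamma> show ?thesis
    by auto
qed

lemma act_sum:
  assumes "finite J" "w \<in> carrier W"
  shows "act w (\<lambda>k. \<Sum>j\<in>J. c j * x j k) = (\<lambda>k. \<Sum>j\<in>J. c j * act w (x j) k)"
  using assms(1)
proof (induction J rule: finite_induct)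
  case empty
  show ?case
    using act_lin[OF assms(2), of 0 undefined 0 undefined] by simp
next
  case (insert j J)
  then show ?case
    using act_lin[OF assms(2), of "c j" "x j" 1 "\<lambda>k. \<Sum>j\<in>J. c j * x j k"] by simp
qed

text \<open>The product of the reflections in pairwise orthogonal simple roots \<open>\<alpha>\<^sub>k\<close>, \<open>k \<in> A\<close>.\<close>

definition reflect_set :: "'i set \<Rightarrow> ('i \<Rightarrow> real) \<Rightarrow> 'i \<Rightarrow> real" where
  "reflect_set A \<beta> = (\<lambda>k. if k \<in> A then \<beta> k - 2 * B \<beta> (simple_root k) else \<beta> k)"

lemma foldr_reflect_set_outside:
  "k \<notin> \<Union> (set xs) \<Longrightarrow> foldr reflect_set xs x k = x k"
  by (induction xs) (auto simp: reflect_set_def)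

text \<open>By orthogonality, the reflections already applied do not change the value of the form
  against the next simple root, so all of them read off the original vector.\<close>

lemma foldr_reflect_orthogonal:
  assumes "distinct xs" "set xs \<subseteq> I"
    and "\<And>i j. i \<in> set xs \<Longrightarrow> j \<in> set xs \<Longrightarrow> i \<noteq> j \<Longrightarrow> gram i j = 0"
  shows "foldr reflect xs = reflect_set (set xs)"
  using assms
proof (induction xs)
  case Nil
  then show ?case by (simp add: reflect_set_def fun_eq_iff)
next
  case (Cons i xs)
  have "gram k i = 0" if "k \<in> set xs" for k
    using Cons.prems that by (metis distinct.simps(2) list.set_intros)
  then have "B (reflect_set (set xs) \<beta>) (simple_root i) = B \<beta> (simple_root i)" for \<beta>
    using Cons.prems by (auto simp: B_simple_root reflect_set_def intro!: sum.cong)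
  then have "reflect i (reflect_set (set xs) \<beta>) = reflect_set (set (i # xs)) \<beta>" for \<beta>
    using Cons.prems by (auto simp: fun_eq_iff reflect_apply reflect_set_def)
  moreover have "foldr reflect xs = reflect_set (set xs)"
    using Cons.prems by (intro Cons.IH) auto
  ultimately show ?case
    by (simp add: comp_def)
qed

lemma gram_eq_0:
  assumes "i \<in> I" "j \<in> I" "i \<noteq> j" "\<not> adjacent i j"
  shows "gram i j = 0"
proof -
  have "m i j = 2"
    using assms m_eq_1_iff[of i j] by (auto simp: adjacent_def)
  then show ?thesis
    by (simp add: gram_def)
qed

end

subsection \<open>The embedding of a folding\<close>

locale coxeter_folding = coxeter_system W I s
  for W :: "('a, 'b) monoid_scheme" (structure) and I :: "'i set" and s +
  fixes \<sigma> W' s'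
  assumes folding: "folding \<sigma> W' s'"

sublocale coxeter_folding \<subseteq> F: coxeter_system W' "orbits \<sigma>" s'
  using folding by (simp add: folding_def)

context coxeter_folding
begin

lemma bij_sigma: "bij_betw \<sigma> I I"
  using folding by (simp add: folding_def graph_automorphism_def)

lemma sigma_in: "i \<in> I \<Longrightarrow> \<sigma> i \<in> I"
  using bij_sigma bij_betwE by blast

lemma sigma_eq_iff: "i \<in> I \<Longrightarrow> j \<in> I \<Longrightarrow> \<sigma> i = \<sigma> j \<longleftrightarrow> i = j"
  using bij_sigma by (auto simp: bij_betw_def dest: inj_onD)

text \<open>The automorphism preserves \<open>m\<close> on edges by definition; on the diagonal and
  on non-edges the form is 1 and 0 on both sides.\<close>

lemma gram_sigma: "i \<in> I \<Longrightarrow> j \<in> I \<Longrightarrow> gram (\<sigma> i) (\<sigma> j) = gram i j"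
proof -
  assume ij: "i \<in> I" "j \<in> I"
  have aut: "adjacent (\<sigma> i) (\<sigma> j) \<longleftrightarrow> adjacent i j" "adjacent i j \<Longrightarrow> m (\<sigma> i) (\<sigma> j) = m i j"
    using folding ij by (auto simp: folding_def graph_automorphism_def)
  consider "i = j" | "adjacent i j" | "i \<noteq> j" "\<not> adjacent i j" by blast
  then show ?thesis
  proof cases
    case 1
    then show ?thesis using ij sigma_in by (simp add: gram_self)
  next
    case 2
    then show ?thesis using aut by (simp add: gram_def)
  next
    case 3
    then show ?thesis using ij aut sigma_in sigma_eq_iff by (simp add: gram_eq_0)
  qed
qed

lemma orbit_subset_I: "i \<in> I \<Longrightarrow> orbit \<sigma> i \<subseteq> I"
proof
  fix k assume "i \<in> I" "k \<in> orbit \<sigma> i"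
  from this(2,1) show "k \<in> I"
    by induction (auto simp: sigma_in)
qed

text \<open>\<open>orbit\<close> starts at \<open>\<sigma> i\<close>, not at \<open>i\<close>. On
  the finite orbit the injective \<open>\<sigma>\<close> is onto, so some element of the orbit is
  mapped to \<open>\<sigma> i\<close>, and it must be \<open>i\<close>.\<close>

lemma self_in_orbit: "i \<in> I \<Longrightarrow> i \<in> orbit \<sigma> i"
proof -
  assume i: "i \<in> I"
  let ?O = "orbit \<sigma> i"
  have "finite ?O"
    using orbit_subset_I[OF i] finite_I finite_subset by blast
  moreover have "inj_on \<sigma> ?O"
    using orbit_subset_I[OF i] by (auto simp: inj_on_def subset_eq sigma_eq_iff)
  moreover have "\<sigma> ` ?O \<subseteq> ?O"
    by (auto intro: orbit.step)
  ultimately have "\<sigma> ` ?O = ?O"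
    by (simp add: endo_inj_surj)
  then obtain k where "k \<in> ?O" "\<sigma> k = \<sigma> i"
    using orbit.base[of \<sigma> i] by (metis imageE)
  then show ?thesis
    using orbit_subset_I[OF i] i sigma_eq_iff by auto
qed

lemma orbits_subset_I: "A \<in> orbits \<sigma> \<Longrightarrow> A \<subseteq> I"
  using orbit_subset_I by (auto simp: orbits_def)

lemma orbits_eq_orbit: "A \<in> orbits \<sigma> \<Longrightarrow> i \<in> A \<Longrightarrow> A = orbit \<sigma> i"
  using self_in_orbit by (auto simp: orbits_def intro: orbit_trans dest: orbit_swap[rotated])

lemma sigma_in_orbit_iff: "A \<in> orbits \<sigma> \<Longrightarrow> i \<in> I \<Longrightarrow> \<sigma> i \<in> A \<longleftrightarrow> i \<in> A"
  using orbits_eq_orbit[of A i] orbits_eq_orbit[of A "\<sigma> i"] orbit.base[of \<sigma> i] self_in_orbit[of i]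
    orbits_eq_orbit[of "orbit \<sigma> i" "\<sigma> i"]
  by (auto simp: orbits_def)

lemma orbits_induct:
  assumes "A \<in> orbits \<sigma>" "i \<in> A" "j \<in> A" "P i" "\<And>k. k \<in> A \<Longrightarrow> P k \<Longrightarrow> P (\<sigma> k)"
  shows "P j"
proof -
  have "\<sigma> k \<in> A \<and> P (\<sigma> k)" if "k \<in> A \<and> P k" for k
    using assms that orbits_subset_I[of A] by (auto simp: sigma_in_orbit_iff subset_eq)
  moreover have "j \<in> orbit \<sigma> i"
    using orbits_eq_orbit assms by blast
  then have "j \<in> A \<and> P j"
    by induction (use calculation assms in blast)+
  then show ?thesis by simp
qed

lemma gram_orbit: "A \<in> orbits \<sigma> \<Longrightarrow> i \<in> A \<Longrightarrow> j \<in> A \<Longrightarrow> i \<noteq> j \<Longrightarrow> gram i j = 0"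
  using folding orbits_subset_I[of A] by (intro gram_eq_0) (auto simp: folding_def)

section \<open>The homomorphism from the folding into \<open>W\<close>\<close>

definition orbit_list :: "'i set \<Rightarrow> 'i list" where
  "orbit_list A = (SOME xs. distinct xs \<and> set xs = A)"

definition expand :: "'i set list \<Rightarrow> 'i list" where
  "expand xs = concat (map orbit_list xs)"

lemma expand_simps [simp]:
  "expand [] = []" "expand (A # xs) = orbit_list A @ expand xs" "expand (xs @ ys) = expand xs @ expand ys"
  by (simp_all add: expand_def)

lemma set_prod_eq: "set_prod A = word W s (orbit_list A)"
  by (simp add: set_prod_def orbit_list_def)

lemma orbit_list:
  assumes "A \<in> orbits \<sigma>"
  shows "distinct (orbit_list A)" "set (orbit_list A) = A"
proof -
  have "finite A"
    using orbits_subset_I[OF assms] finite_I finite_subset by blast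
  then have "\<exists>xs. distinct xs \<and> set xs = A"
    using finite_distinct_list by blast
  from someI_ex[OF this] show "distinct (orbit_list A)" "set (orbit_list A) = A"
    by (simp_all add: orbit_list_def)
qed

lemma set_expand: "set xs \<subseteq> orbits \<sigma> \<Longrightarrow> set (expand xs) = \<Union> (set xs)"
  by (auto simp: expand_def orbit_list subset_eq)

lemma set_expand_subset: "set xs \<subseteq> orbits \<sigma> \<Longrightarrow> set (expand xs) \<subseteq> I"
  using orbits_subset_I by (subst set_expand) auto

lemma foldr_reflect_orbit_list: "A \<in> orbits \<sigma> \<Longrightarrow> foldr reflect (orbit_list A) = reflect_set A"
  using foldr_reflect_orthogonal[of "orbit_list A"] orbit_list[of A] orbits_subset_I[of A] gram_orbit[of A]
  by simp

lemma foldr_reflect_expand: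
  "set xs \<subseteq> orbits \<sigma> \<Longrightarrow> foldr reflect (expand xs) = foldr reflect_set xs"
  by (induction xs) (auto simp: foldr_reflect_orbit_list intro!: ext)

text \<open>Here the definition of the folding enters: faithfulness turns the identity of functions
  into one in \<open>W\<close>, where the order is \<open>F.m A A'\<close> by definition. One
  direction makes \<open>emb\<close> well defined, the other bounds \<open>F.m A A'\<close> in the
  positivity argument.\<close>

lemma foldr_reflect_set_braid_iff:
  assumes "A \<in> orbits \<sigma>" "A' \<in> orbits \<sigma>"
  shows "foldr reflect_set (concat (replicate n [A, A'])) = id \<longleftrightarrow> F.m A A' dvd n"
proof -
  have expand: "expand (concat (replicate k [A, A'])) = concat (replicate k (orbit_list A @ orbit_list A'))" for k
    by (induction k) auto
  have sub: "set (concat (replicate n [A, A'])) \<subseteq> orbits \<sigma>"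
    using assms by (auto split: if_splits)
  have ls: "set (orbit_list A) \<subseteq> I" "set (orbit_list A') \<subseteq> I"
    using assms orbit_list orbits_subset_I by simp_all
  have "foldr reflect_set (concat (replicate n [A, A'])) = id \<longleftrightarrow>
      word W s (expand (concat (replicate n [A, A']))) = word W s []"
    using word_eq_iff_foldr_reflect_eq[of "expand (concat (replicate n [A, A']))" "[]"]
      set_expand_subset[OF sub] foldr_reflect_expand[OF sub] by (simp add: id_def fun_eq_iff)
  also have "\<dots> \<longleftrightarrow> (set_prod A \<otimes> set_prod A') [^] n = \<one>"
    unfolding expand by (simp only: word_concat_replicate_pair[OF ls] word_Nil set_prod_eq)
  also have "\<dots> \<longleftrightarrow> ord (set_prod A \<otimes> set_prod A') dvd n"
    using ls by (intro pow_eq_id) (simp add: set_prod_eq)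
  also have "ord (set_prod A \<otimes> set_prod A') = F.m A A'"
    using folding assms by (simp add: folding_def)
  finally show ?thesis .
qed

lemma reflect_set_involution: "A \<in> orbits \<sigma> \<Longrightarrow> reflect_set A (reflect_set A x) = x"
  using foldr_reflect_set_braid_iff[of A A 1] F.m_self[of A] by (auto simp: fun_eq_iff)

text \<open>The maps \<open>reflect_set A\<close> satisfy the relations of \<open>W'\<close>, so
  they depend only on the element of \<open>W'\<close>; faithfulness carries this back to
  \<open>W\<close>.\<close>

lemma word_expand_cong:
  assumes "set xs \<subseteq> orbits \<sigma>" "set ys \<subseteq> orbits \<sigma>" "word W' s' xs = word W' s' ys"
  shows "word W s (expand xs) = word W s (expand ys)"
proof -
  have "foldr reflect_set (concat (replicate (F.m A A') [A, A'])) x = x"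
    if "A \<in> orbits \<sigma>" "A' \<in> orbits \<sigma>" for A A' x
    using foldr_reflect_set_braid_iff[OF that, of "F.m A A'"] by simp
  then have "foldr reflect_set xs = foldr reflect_set ys"
    using assms reflect_set_involution by (intro F.word_eq_imp_foldr_eq)
  then show ?thesis
    using assms set_expand_subset by (simp add: word_eq_iff_foldr_reflect_eq foldr_reflect_expand)
qed

text \<open>The map \<open>\<phi>\<close>, computed from a chosen word; \<open>emb_word\<close>
  allows any word.\<close>

definition emb where
  "emb u = word W s (expand (SOME xs. set xs \<subseteq> orbits \<sigma> \<and> word W' s' xs = u))"

lemma emb_word: "set xs \<subseteq> orbits \<sigma> \<Longrightarrow> emb (word W' s' xs) = word W s (expand xs)"
proof -
  assume xs: "set xs \<subseteq> orbits \<sigma>"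
  let ?ys = "SOME ys. set ys \<subseteq> orbits \<sigma> \<and> word W' s' ys = word W' s' xs"
  have "set ?ys \<subseteq> orbits \<sigma> \<and> word W' s' ?ys = word W' s' xs"
    by (rule someI[of _ xs]) (use xs in simp)
  then show ?thesis
    unfolding emb_def using xs by (intro word_expand_cong) auto
qed

lemma emb_closed [simp]: "u \<in> carrier W' \<Longrightarrow> emb u \<in> carrier W"
  using F.ex_word[of u] emb_word set_expand_subset by (metis word_closed)

lemma emb_mult:
  "u \<in> carrier W' \<Longrightarrow> v \<in> carrier W' \<Longrightarrow> emb (u \<otimes>\<^bsub>W'\<^esub> v) = emb u \<otimes> emb v"
proof -
  assume "u \<in> carrier W'" "v \<in> carrier W'"
  then obtain xs ys where "set xs \<subseteq> orbits \<sigma>" "word W' s' xs = u" "set ys \<subseteq> orbits \<sigma>" "word W' s' ys = v"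
    using F.ex_word by meson
  then show ?thesis
    using emb_word[of xs] emb_word[of ys] emb_word[of "xs @ ys"] set_expand_subset[of xs] set_expand_subset[of ys]
    by auto
qed

lemma emb_one: "emb \<one>\<^bsub>W'\<^esub> = \<one>"
  using emb_word[of "[]"] by simp

lemma emb_s: "A \<in> orbits \<sigma> \<Longrightarrow> emb (s' A) = word W s (orbit_list A)"
  using emb_word[of "[A]"] by simp

lemma emb_inv: "u \<in> carrier W' \<Longrightarrow> emb (inv\<^bsub>W'\<^esub> u) = inv (emb u)"
  using emb_mult[of "inv\<^bsub>W'\<^esub> u" u] by (intro inv_equality[symmetric]) (simp_all add: emb_one)

lemma act_emb_word: "set xs \<subseteq> orbits \<sigma> \<Longrightarrow> act (emb (word W' s' xs)) = foldr reflect_set xs"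
  by (simp add: emb_word act_word set_expand_subset foldr_reflect_expand)

subsection \<open>Positivity along the embedding\<close>

text \<open>\<open>y\<close> is the image of \<open>x\<close> when \<open>\<sigma>\<close> permutes the coordinates indexed by \<open>I\<close>.\<close>

definition sigma_related :: "('i \<Rightarrow> real) \<Rightarrow> ('i \<Rightarrow> real) \<Rightarrow> bool" where
  "sigma_related x y \<longleftrightarrow> (\<forall>i\<in>I. y (\<sigma> i) = x i)"

lemma B_sigma_related:
  assumes "sigma_related x y" "i \<in> I"
  shows "B y (simple_root (\<sigma> i)) = B x (simple_root i)"
proof -
  have "B y (simple_root (\<sigma> i)) = (\<Sum>k\<in>I. y (\<sigma> k) * gram (\<sigma> k) (\<sigma> i))"
    using assms sigma_in by (simp add: B_simple_root sum.reindex_bij_betw[OF bij_sigma, of "\<lambda>k. y k * gram k (\<sigma> i)"])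
  then show ?thesis
    using assms by (simp add: B_simple_root gram_sigma sigma_related_def)
qed

lemma sigma_related_reflect_set:
  "sigma_related x y \<Longrightarrow> A \<in> orbits \<sigma> \<Longrightarrow> sigma_related (reflect_set A x) (reflect_set A y)"
  using B_sigma_related[of x y] by (simp add: sigma_related_def reflect_set_def sigma_in_orbit_iff)

lemma sigma_related_foldr:
  assumes "sigma_related x y" "set xs \<subseteq> orbits \<sigma>"
  shows "sigma_related (foldr reflect_set xs x) (foldr reflect_set xs y)"
  using assms(2) by (induction xs) (simp_all add: assms(1) sigma_related_reflect_set)

text \<open>Products of the maps \<open>reflect_set A\<close> commute with the permutation of
  coordinates by \<open>\<sigma>\<close>.\<close>

lemma foldr_reflect_set_simple_sigma:
  assumes xs: "set xs \<subseteq> orbits \<sigma>" and ij: "i \<in> I" "j \<in> I"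
    and eq: "foldr reflect_set xs (simple_root i) = simple_root j"
  shows "foldr reflect_set xs (simple_root (\<sigma> i)) = simple_root (\<sigma> j)"
proof
  fix k
  have "sigma_related (simple_root i) (simple_root (\<sigma> i))"
    using ij by (auto simp: sigma_related_def simple_root_def sigma_eq_iff)
  then have rel: "sigma_related (simple_root j) (foldr reflect_set xs (simple_root (\<sigma> i)))"
    using sigma_related_foldr[OF _ xs] eq by metis
  show "foldr reflect_set xs (simple_root (\<sigma> i)) k = simple_root (\<sigma> j) k"
  proof (cases "k \<in> I")
    case True
    then obtain l where "l \<in> I" "k = \<sigma> l"
      using bij_sigma by (auto simp: bij_betw_def)
    then show ?thesis
      using rel ij by (auto simp: sigma_related_def simple_root_def sigma_eq_iff)
  next
    case False
    \<comment> \<open>\<open>sigma_related\<close> says nothing outside \<open>I\<close>; there both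
      sides vanish.\<close>
    then have "foldr reflect_set xs (simple_root (\<sigma> i)) k = 0"
      using act_simple_outside[of "word W s (expand xs)" "\<sigma> i" k] xs ij
      by (simp add: sigma_in act_word set_expand_subset foldr_reflect_expand)
    then show ?thesis
      using False ij sigma_in by (auto simp: simple_root_def)
  qed
qed

text \<open>One pair of simple roots matched by the product spreads along \<open>\<sigma>\<close>:
  the product carries the simple roots of \<open>A\<close> bijectively onto those of
  \<open>C\<close>, hence conjugates the reflections of \<open>A\<close> into those of
  \<open>C\<close>.\<close>

lemma foldr_reflect_set_intertwine:
  assumes xs: "set xs \<subseteq> orbits \<sigma>" and A: "A \<in> orbits \<sigma>" "C \<in> orbits \<sigma>" and ij: "i \<in> A" "j \<in> C"
    and eq: "foldr reflect_set xs (simple_root i) = simple_root j"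
  shows "foldr reflect_set xs (reflect_set A \<beta>) = reflect_set C (foldr reflect_set xs \<beta>)"
proof -
  define g where "g = foldr reflect_set xs"
  have g: "g = foldr reflect (expand xs)"
    using xs by (simp add: g_def foldr_reflect_expand)
  have inj: "x = y" if "g x = g y" for x y
    using that foldr_involutions_rev(1)[of "expand xs" reflect] set_expand_subset[OF xs] reflect_reflect
    unfolding g by (metis subsetD)
  have sub: "A \<subseteq> I" "C \<subseteq> I"
    using A orbits_subset_I by auto
  have sigma: "\<sigma> k \<in> A \<and> \<sigma> l \<in> C \<and> g (simple_root (\<sigma> k)) = simple_root (\<sigma> l)"
    if "k \<in> A" "l \<in> C" "g (simple_root k) = simple_root l" for k l
    using that foldr_reflect_set_simple_sigma[OF xs, of k l] sub A
    by (auto simp: g_def subset_eq sigma_in_orbit_iff)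
  have ij_eq: "g (simple_root i) = simple_root j"
    using eq by (simp add: g_def)
  have ex: "\<exists>l\<in>C. g (simple_root k) = simple_root l" if "k \<in> A" for k
    using A(1) ij(1) that by (rule orbits_induct) (use ij_eq ij sigma in blast)+
  have ex': "\<exists>k\<in>A. g (simple_root k) = simple_root l" if "l \<in> C" for l
    using A(2) ij(2) that by (rule orbits_induct) (use ij_eq ij sigma in blast)+
  obtain f where f: "\<And>k. k \<in> A \<Longrightarrow> f k \<in> C" "\<And>k. k \<in> A \<Longrightarrow> g (simple_root k) = simple_root (f k)"
    using ex by metis
  have "inj_on f A"
    using f inj by (intro inj_onI) (metis simple_root_eq_iff)
  moreover have "f ` A = C"
    using f ex' by (auto simp: image_iff) (metis simple_root_eq_iff)
  ultimately have f_list: "distinct (map f (orbit_list A))" "set (map f (orbit_list A)) = C"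
    using orbit_list[OF A(1)] by (auto simp: distinct_map)
  \<comment> \<open>As a linear isometry, \<open>g\<close> transports the reflection in a root to
    the reflection in its image.\<close>
  have step: "g (reflect k \<beta>) = reflect (f k) (g \<beta>)" if "k \<in> A" for k \<beta>
  proof -
    have "B (g \<beta>) (simple_root (f k)) = B \<beta> (simple_root k)"
      unfolding f(2)[OF that, symmetric] unfolding g
      using set_expand_subset[OF xs] by (rule B_foldr_reflect)
    then show ?thesis
      using f(2)[OF that] unfolding g by (simp only: reflect_alt_def foldr_reflect_lin)
  qed
  have "g (foldr reflect ks \<beta>) = foldr reflect (map f ks) (g \<beta>)" if "set ks \<subseteq> A" for ks
    using that by (induction ks) (auto simp: step)
  from this[of "orbit_list A"] have "g (reflect_set A \<beta>) = foldr reflect (map f (orbit_list A)) (g \<beta>)"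
    using A by (simp add: orbit_list foldr_reflect_orbit_list)
  also have "foldr reflect (map f (orbit_list A)) = reflect_set C"
    using foldr_reflect_orthogonal[OF f_list(1)] f_list(2) sub gram_orbit[OF A(2)] by simp
  finally show ?thesis
    by (simp add: g_def)
qed

text \<open>
  If a further factor \<open>C\<close> makes a positive \<open>g \<alpha>\<^sub>i\<close> negative, then \<open>g \<alpha>\<^sub>i\<close> is a simple root indexed in \<open>C\<close>,
  so \<open>g\<close> intertwines the factors \<open>A\<close> and \<open>C\<close>; the two alternating words of length \<open>n + 1\<close> then agree,
  which bounds \<open>m(A,A')\<close> by \<open>n + 1\<close>.
\<close>

lemma foldr_reflect_set_alt_nonneg:
  assumes A: "A \<in> orbits \<sigma>" "A' \<in> orbits \<sigma>" and i: "i \<in> A"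
    and n: "F.m A A' = 0 \<or> n < F.m A A'" and k: "k \<in> I"
  shows "0 \<le> foldr reflect_set (alt n A' A) (simple_root i) k"
  using n k
proof (induction n arbitrary: k)
  case 0
  then show ?case by (simp add: simple_root_def)
next
  case (Suc n)
  let ?g = "foldr reflect_set (alt n A' A)"
  define C where "C = (if even n then A' else A)"
  have C: "C \<in> orbits \<sigma>" and alt: "alt (Suc n) A' A = C # alt n A' A"
    using A unfolding C_def by (auto simp: alt_Cons simp del: alt.simps)
  have sub: "set (alt p A A') \<subseteq> orbits \<sigma>" "set (alt p A' A) \<subseteq> orbits \<sigma>" for p
    using set_alt[of p A A'] set_alt[of p A' A] A by auto
  have iI: "i \<in> I"
    using i A orbits_subset_I by blast
  have IH: "0 \<le> ?g (simple_root i) k" if "k \<in> I" for k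
    using Suc that by auto
  show ?case
  proof (rule ccontr)
    assume "\<not> ?thesis"
    then have neg: "reflect_set C (?g (simple_root i)) k < 0"
      unfolding alt by simp
    then have kC: "k \<in> C"
      using IH[of k] Suc.prems by (auto simp: reflect_set_def split: if_splits)
    \<comment> \<open>Since \<open>k\<close> lies in \<open>C\<close>, the maps
      \<open>reflect_set C\<close> and \<open>reflect k\<close> give the same coordinate
      \<open>k\<close>, so the criterion for a single reflection applies.\<close>
    have "act (word W s (expand (alt n A' A))) (simple_root i) = simple_root k"
      using neg kC IH Suc.prems iI sub
      by (intro nonneg_root_eq_simple)
        (auto simp: act_word set_expand_subset foldr_reflect_expand reflect_set_def reflect_apply)
    then have "?g (simple_root i) = simple_root k"
      using sub by (simp add: act_word set_expand_subset foldr_reflect_expand)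
    then have inter: "?g (reflect_set A \<beta>) = reflect_set C (?g \<beta>)" for \<beta>
      using foldr_reflect_set_intertwine[OF sub(2) A(1) C i kC] by blast
    \<comment> \<open>The left word is \<open>alt n A' A\<close> followed by \<open>A\<close>, and
      the intertwining moves this last factor to the front as \<open>C\<close>.\<close>
    have "foldr reflect_set (alt (Suc n) A A') = foldr reflect_set (alt (Suc n) A' A)"
      unfolding alt by (simp add: fun_eq_iff inter[unfolded fun_eq_iff])
    then have "foldr reflect_set (rev (alt (Suc n) A A') @ alt (Suc n) A' A) =
        foldr reflect_set (rev (alt (Suc n) A A')) \<circ> foldr reflect_set (alt (Suc n) A A')"
      by (intro ext) (simp only: foldr_append comp_apply)
    also have "\<dots> = id"
      using foldr_involutions_rev(1)[of "alt (Suc n) A A'" reflect_set] reflect_set_involution sub(1)[of "Suc n"]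
      by (auto simp: fun_eq_iff simp del: alt.simps)
    finally have "F.m A A' dvd Suc n"
      by (simp only: rev_alt_append_alt foldr_reflect_set_braid_iff[OF A])
    then show False
      using Suc.prems by (auto dest: dvd_imp_le)
  qed
qed

text \<open>The induction runs in \<open>W'\<close> while the signs are taken in \<open>W\<close>.
  The alternating word sends \<alpha>_i to a nonnegative combination of simple roots from
  \<open>A\<close> and \<open>A'\<close>, so the induction hypothesis must cover all indices of both
  orbits.\<close>

lemma ascent_imp_act_emb_nonneg:
  assumes "u \<in> carrier W'" "A \<in> orbits \<sigma>" "F.ascent u A" "i \<in> A" "k \<in> I"
  shows "0 \<le> act (emb u) (simple_root i) k"
proof -
  have "\<forall>i\<in>A. \<forall>k\<in>I. 0 \<le> act (emb u) (simple_root i) k"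
    using assms(1-3)
  proof (induction rule: F.ascent_induct)
    case (step v A A' n)
    have sub: "set (alt n A' A) \<subseteq> orbits \<sigma>"
      using set_alt[of n A' A] step by auto
    have fin: "finite (A \<union> A')" and AI: "A \<union> A' \<subseteq> I"
      using orbits_subset_I step finite_I by (auto intro: finite_subset)
    show ?case
    proof (intro ballI)
      fix i k assume i: "i \<in> A" and k: "k \<in> I"
      define \<gamma> where "\<gamma> = foldr reflect_set (alt n A' A) (simple_root i)"
      have nonneg: "\<gamma> j \<ge> 0" if "j \<in> A \<union> A'" for j
        unfolding \<gamma>_def using foldr_reflect_set_alt_nonneg[of A A' i n j] step i that AI by auto
      \<comment> \<open>The alternating word changes only coordinates in the two orbits, and
        \<alpha>_i has no others.\<close>
      have "\<gamma> j = 0" if "j \<notin> A \<union> A'" for j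
      proof -
        have "j \<notin> \<Union> (set (alt n A' A))"
          using set_alt[of n A' A] that by auto
        then have "\<gamma> j = simple_root i j"
          unfolding \<gamma>_def by (rule foldr_reflect_set_outside)
        then show ?thesis
          using that i by (auto simp: simple_root_def)
      qed
      then have \<gamma>: "\<gamma> = (\<lambda>l. \<Sum>j\<in>A \<union> A'. \<gamma> j * simple_root j l)"
        using fin by (auto simp: simple_root_def fun_eq_iff if_distrib[of "\<lambda>x. _ * x"] cong: if_cong)
      have "act (emb v) \<gamma> = (\<lambda>l. \<Sum>j\<in>A \<union> A'. \<gamma> j * act (emb v) (simple_root j) l)"
        by (rule trans[OF arg_cong[where f = "act (emb v)", OF \<gamma>]
              act_sum[OF fin emb_closed[OF step(1)], of \<gamma> simple_root]])
      moreover have "act (emb (v \<otimes>\<^bsub>W'\<^esub> word W' s' (alt n A' A))) (simple_root i) = act (emb v) \<gamma>"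
        using step sub by (simp add: emb_mult act_mult act_emb_word \<gamma>_def)
      ultimately show "0 \<le> act (emb (v \<otimes>\<^bsub>W'\<^esub> word W' s' (alt n A' A))) (simple_root i) k"
        using nonneg step k by (auto intro!: sum_nonneg mult_nonneg_nonneg)
    qed
  qed (simp add: emb_one act_one simple_root_def)
  with assms show ?thesis by blast
qed

lemma reflect_set_simple:
  assumes "A \<in> orbits \<sigma>" "i \<in> A"
  shows "reflect_set A (simple_root i) = (\<lambda>k. - simple_root i k)"
proof
  fix k
  have "k \<in> A \<Longrightarrow> i \<in> I \<and> k \<in> I"
    using assms orbits_subset_I by auto
  then show "reflect_set A (simple_root i) k = - simple_root i k"
    using assms gram_orbit[of A i k]
    by (cases "k = i") (simp_all add: reflect_set_def B_simple_simple gram_self, simp_all add: simple_root_def)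
qed

text \<open>If \<open>A\<close> is a descent of \<open>u\<close>, then it is an ascent of
  \<open>u\<close> times \<open>s' A\<close>. As the image of \<open>s' A\<close> negates
  \<alpha>_i, the root in question would be both nonnegative and nonpositive.\<close>

lemma ascent_emb_iff:
  assumes u: "u \<in> carrier W'" and A: "A \<in> orbits \<sigma>" "i \<in> A"
  shows "ascent (emb u) i \<longleftrightarrow> F.ascent u A"
proof
  have i: "i \<in> I"
    using A orbits_subset_I by blast
  assume asc: "ascent (emb u) i"
  show "F.ascent u A"
  proof (rule ccontr)
    assume "\<not> F.ascent u A"
    then have "F.ascent (u \<otimes>\<^bsub>W'\<^esub> s' A) A"
      using u A F.not_ascentD by blast
    moreover have "act (emb (u \<otimes>\<^bsub>W'\<^esub> s' A)) (simple_root i) = (\<lambda>k. - act (emb u) (simple_root i) k)"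
      using u A i act_emb_word[of "[A]"] act_lin[of "emb u" "-1" "simple_root i" 0 "simple_root i"]
      by (simp add: emb_mult act_mult reflect_set_simple)
    ultimately have "act (emb u) (simple_root i) k \<le> 0" if "k \<in> I" for k
      using ascent_imp_act_emb_nonneg[of "u \<otimes>\<^bsub>W'\<^esub> s' A" A i k] u A that by simp
    moreover have "0 \<le> act (emb u) (simple_root i) k" if "k \<in> I" for k
      using ascent_imp_act_nonneg[of "emb u" i k] asc u i that by simp
    ultimately show False
      using ex_act_simple_neq_0[of "emb u" i] u i by (metis emb_closed order_antisym)
  qed
next
  assume "F.ascent u A"
  then show "ascent (emb u) i"
    using ascent_imp_act_emb_nonneg[of u A i] u A orbits_subset_I[of A]
    by (subst ascent_iff_act_nonneg) auto
qed

subsection \<open>Lifting convex sets\<close>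

definition lift where
  "lift L = {w \<in> carrier W. \<forall>u\<in>carrier W'. \<forall>A\<in>orbits \<sigma>. \<forall>i\<in>A.
    F.act u (F.simple_root A) \<in> F.R L \<longrightarrow> w \<in> half_space (act (emb u) (simple_root i))}"

lemma convex_lift: "convex (lift L)"
proof -
  define Q where "Q = {act (emb u) (simple_root i) | u A i. u \<in> carrier W' \<and> A \<in> orbits \<sigma> \<and> i \<in> A \<and>
    F.act u (F.simple_root A) \<in> F.R L}"
  have "Q \<subseteq> roots"
    using orbits_subset_I by (auto simp: Q_def intro!: act_simple_in_roots)
  moreover have "lift L = carrier W \<inter> (\<Inter>\<beta>\<in>Q. half_space \<beta>)"
    by (auto simp: lift_def Q_def)
  ultimately show ?thesis
    unfolding convex_def by blast
qed

text \<open>Both sides are sign conditions on the single element \<open>x\<close> times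
  \<open>u\<close>.\<close>

lemma emb_in_half_space_iff:
  assumes "x \<in> carrier W'" "u \<in> carrier W'" "A \<in> orbits \<sigma>" "i \<in> A"
  shows "emb x \<in> half_space (act (emb u) (simple_root i)) \<longleftrightarrow>
    x \<in> F.half_space (F.act u (F.simple_root A))"
proof -
  have i: "i \<in> I"
    using assms orbits_subset_I by blast
  have "emb x \<in> half_space (act (emb u) (simple_root i)) \<longleftrightarrow>
      act (emb (x \<otimes>\<^bsub>W'\<^esub> u)) (simple_root i) \<in> pos_roots"
    using assms by (simp add: half_space_def emb_mult act_mult)
  also have "\<dots> \<longleftrightarrow> F.act (x \<otimes>\<^bsub>W'\<^esub> u) (F.simple_root A) \<in> F.pos_roots"
    using assms i ascent_emb_iff[of "x \<otimes>\<^bsub>W'\<^esub> u" A i]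
    by (simp add: act_simple_in_pos_roots_iff F.act_simple_in_pos_roots_iff)
  also have "\<dots> \<longleftrightarrow> x \<in> F.half_space (F.act u (F.simple_root A))"
    using assms by (simp add: F.half_space_def F.act_mult)
  finally show ?thesis .
qed

text \<open>Every root in a family cutting out \<open>L\<close> belongs to \<open>F.R L\<close>, so
  the half-spaces defining \<open>lift L\<close> already enforce membership in
  \<open>L\<close>.\<close>

lemma emb_in_lift_iff:
  assumes L: "F.convex L" and x: "x \<in> carrier W'"
  shows "emb x \<in> lift L \<longleftrightarrow> x \<in> L"
proof
  obtain Q where Q: "Q \<subseteq> F.roots" "L = carrier W' \<inter> (\<Inter>\<beta>\<in>Q. F.half_space \<beta>)"
    using L by (auto simp: F.convex_def)
  assume lift: "emb x \<in> lift L"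
  have "x \<in> F.half_space \<beta>" if \<beta>: "\<beta> \<in> Q" for \<beta>
  proof -
    obtain u A where u: "\<beta> = F.act u (F.simple_root A)" "u \<in> carrier W'" "A \<in> orbits \<sigma>"
      using Q(1) \<beta> unfolding F.roots_def by blast
    then obtain i where "i \<in> A"
      using orbit_nonempty by (fastforce simp: orbits_def)
    moreover have "\<beta> \<in> F.R L"
      using Q \<beta> by (auto simp: F.R_def)
    ultimately show ?thesis
      using lift u x emb_in_half_space_iff[of x u A i] by (auto simp: lift_def)
  qed
  then show "x \<in> L"
    using Q x by simp
next
  assume "x \<in> L"
  then show "emb x \<in> lift L"
    using x by (auto simp: lift_def F.R_def emb_in_half_space_iff)
qed

text \<open>A half-space containing \<open>lift L\<close> contains the image of \<open>L\<close>,
  and on that image the two half-spaces correspond. The converse is built into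
  \<open>lift\<close>.\<close>

lemma act_in_R_lift_iff:
  assumes L: "F.convex L" and u: "u \<in> carrier W'" and A: "A \<in> orbits \<sigma>" "i \<in> A"
  shows "act (emb u) (simple_root i) \<in> R (lift L) \<longleftrightarrow> F.act u (F.simple_root A) \<in> F.R L"
proof
  assume *: "act (emb u) (simple_root i) \<in> R (lift L)"
  have "L \<subseteq> F.half_space (F.act u (F.simple_root A))"
  proof
    fix x assume x: "x \<in> L"
    then have "x \<in> carrier W'"
      using L by (auto simp: F.convex_def)
    then show "x \<in> F.half_space (F.act u (F.simple_root A))"
      using * x emb_in_lift_iff[OF L] emb_in_half_space_iff[of x u A i] u A by (auto simp: R_def)
  qed
  then show "F.act u (F.simple_root A) \<in> F.R L"
    using u A by (simp add: F.R_def F.act_simple_in_roots)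
next
  assume "F.act u (F.simple_root A) \<in> F.R L"
  then have "lift L \<subseteq> half_space (act (emb u) (simple_root i))"
    using u A by (auto simp: lift_def)
  then show "act (emb u) (simple_root i) \<in> R (lift L)"
    using u A orbits_subset_I[of A] by (auto simp: R_def act_simple_in_roots)
qed

section \<open>Toggles and promotion under the embedding\<close>

text \<open>Reflections in orthogonal simple roots fix \<alpha>_j, so toggling other indices of the
  orbit does not affect the test at \<open>j\<close>.\<close>

lemma act_inv_word_orbit_list:
  assumes A: "A \<in> orbits \<sigma>" "set js \<subseteq> A" and j: "j \<in> A" "j \<notin> set js" and w: "w \<in> carrier W"
  shows "act (inv (word W s js \<otimes> w)) (simple_root j) = act (inv w) (simple_root j)"
proof -
  have sub: "set js \<subseteq> I" and jI: "j \<in> I"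
    using A j orbits_subset_I by blast+
  have "foldr reflect ks (simple_root j) = simple_root j" if "set ks \<subseteq> A - {j}" for ks
    using that
  proof (induction ks)
    case (Cons k ks)
    have "k \<in> I"
      using Cons.prems A(1) orbits_subset_I by auto
    then have "B (simple_root j) (simple_root k) = 0"
      using gram_orbit[OF A(1) j(1), of k] Cons.prems jI by (auto simp: B_simple_simple)
    then show ?case
      using Cons by (simp add: reflect_orthogonal)
  qed simp
  from this[of "rev js"] have "act (word W s (rev js)) (simple_root j) = simple_root j"
    using A j sub by (auto simp: act_word)
  then have "act (inv (word W s js)) (simple_root j) = simple_root j"
    by (simp only: word_rev[OF sub])
  then show ?thesis
    using w sub by (simp add: inv_mult_group act_mult)
qed

text \<open>All tests in \<open>A\<close> have the same outcome, namely that of \<open>A\<close> on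
  \<open>u\<close>: either every toggle stays put or every toggle multiplies, and then the product
  is the image of \<open>s' A\<close>.\<close>

lemma foldr_toggle_orbit_list:
  assumes L: "F.convex L" and u: "u \<in> carrier W'" and A: "A \<in> orbits \<sigma>"
  shows "foldr (toggle (lift L)) (orbit_list A) (emb u) = emb (F.toggle L A u)"
proof -
  have R_iff: "act (inv (emb u)) (simple_root i) \<in> R (lift L) \<longleftrightarrow>
      F.act (inv\<^bsub>W'\<^esub> u) (F.simple_root A) \<in> F.R L" if "i \<in> A" for i
    using act_in_R_lift_iff[OF L, of "inv\<^bsub>W'\<^esub> u" A i] u A that by (simp add: emb_inv)
  show ?thesis
  proof (cases "F.act (inv\<^bsub>W'\<^esub> u) (F.simple_root A) \<in> F.R L")
    case True
    then have "foldr (toggle (lift L)) js (emb u) = emb u" if "set js \<subseteq> A" for js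
      using that by (induction js) (auto simp: toggle_def R_iff)
    then show ?thesis
      using True orbit_list[OF A] by (simp add: F.toggle_def)
  next
    case False
    have "foldr (toggle (lift L)) js (emb u) = word W s js \<otimes> emb u" if "set js \<subseteq> A" "distinct js" for js
      using that
    proof (induction js)
      case (Cons j js)
      then have "act (inv (word W s js \<otimes> emb u)) (simple_root j) \<notin> R (lift L)"
        using act_inv_word_orbit_list[OF A, of js j "emb u"] u False by (simp add: R_iff)
      moreover have "j \<in> I" "set js \<subseteq> I"
        using Cons.prems A orbits_subset_I by auto
      ultimately show ?case
        using Cons u by (simp add: toggle_def m_assoc)
    qed (simp add: u)
    then show ?thesis
      using False orbit_list[OF A] u A by (simp add: F.toggle_def emb_mult emb_s)
  qed
qed

text \<open>Membership in the carrier is carried along because the next toggle is applied to the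
  intermediate point.\<close>

lemma Pro_expand:
  assumes L: "F.convex L" and u: "u \<in> carrier W'" and xs: "set xs \<subseteq> orbits \<sigma>"
  shows "F.Pro L xs u \<in> carrier W' \<and> Pro (lift L) (expand xs) (emb u) = emb (F.Pro L xs u)"
  using xs
proof (induction xs)
  case Nil
  then show ?case
    using u by (simp add: Pro_def F.Pro_def)
next
  case (Cons A xs)
  then show ?case
    using foldr_toggle_orbit_list[OF L] by (auto simp: Pro_def F.Pro_def F.toggle_def)
qed

lemma expand_in_orderings:
  assumes "xs \<in> F.orderings"
  shows "expand xs \<in> orderings"
proof -
  have xs: "distinct xs" "set xs = orbits \<sigma>"
    using assms by (auto simp: F.orderings_def)
  have "\<Union> (orbits \<sigma>) = I"
    using orbits_subset_I self_in_orbit by (auto simp: orbits_def)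
  then have "set (expand xs) = I"
    using xs by (simp add: set_expand)
  moreover have "distinct (expand ys)" if "distinct ys" "set ys \<subseteq> orbits \<sigma>" for ys
    using that
  proof (induction ys)
    case (Cons A ys)
    have "A \<inter> C = {}" if "C \<in> set ys" for C
      using orbits_eq_orbit[of A] orbits_eq_orbit[of C] Cons.prems that by fastforce
    then show ?case
      using Cons by (auto simp: orbit_list set_expand)
  qed simp
  ultimately show ?thesis
    using xs by (simp add: orderings_def)
qed

lemma futuristic_folding:
  assumes fut: futuristic
  shows F.futuristic
  unfolding F.futuristic_def F.heavy_def
proof (intro allI impI ballI)
  fix L c xs u
  assume L: "L \<noteq> {} \<and> F.convex L" and xs: "xs \<in> F.orderings"
    and u: "u \<in> carrier W'" and "\<exists>K\<ge>1. (F.Pro L xs ^^ K) u = u"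
  then obtain K where K: "K \<ge> 1" "(F.Pro L xs ^^ K) u = u" by blast
  have sub: "set xs \<subseteq> orbits \<sigma>"
    using xs by (simp add: F.orderings_def)
  have "(F.Pro L xs ^^ k) u \<in> carrier W' \<and>
      (Pro (lift L) (expand xs) ^^ k) (emb u) = emb ((F.Pro L xs ^^ k) u)" for k
    using u L sub by (induction k) (auto simp: Pro_expand)
  then have "(Pro (lift L) (expand xs) ^^ K) (emb u) = emb u"
    using K by simp
  moreover obtain x where "x \<in> L" "x \<in> carrier W'"
    using L by (auto simp: F.convex_def)
  \<comment> \<open>The image of any point of \<open>L\<close> is a witness.\<close>
  then have "lift L \<noteq> {}"
    using emb_in_lift_iff[of L x] L by auto
  then have "heavy (lift L) (word W s (expand xs))"
    using fut convex_lift expand_in_orderings[OF xs] by (auto simp: futuristic_def coxeter_elements_def)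
  ultimately have "emb u \<in> lift L"
    using K(1) emb_closed[OF u] expand_in_orderings[OF xs] unfolding heavy_def by blast
  then show "u \<in> L"
    using emb_in_lift_iff L u by blast
qed

end

theorem proposition1p13:
  fixes W :: "('g, 'b) monoid_scheme" and I :: "'i set" and s :: "'i \<Rightarrow> 'g"
    and \<sigma> :: "'i \<Rightarrow> 'i"
    and W' :: "('h, 'c) monoid_scheme" and s' :: "'i set \<Rightarrow> 'h"
  assumes "coxeter_system W I s"
    and "coxeter_system.folding W I s \<sigma> W' s'"
    and "coxeter_system.futuristic W I s"
  shows "coxeter_system.futuristic W' (coxeter_system.orbits I \<sigma>) s'"
proof -
  interpret coxeter_system W I s
    by (rule assms(1))
  interpret coxeter_folding W I s \<sigma> W' s'
    by unfold_locales (rule assms(2))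
  show ?thesis
    using assms(3) by (rule futuristic_folding)
qed

end
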